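(* Let $M_\nu^{m+1}$ be a semi-Riemannian manifold and let $\Sigma^m\subset M_\nu^{m+1}$ be a non-lightlike orientable hypersurface with unit normal vector field $\xi$. Then $\Sigma^m$ is totally umbilical if and only if $\xi$ minimizes rotation along every non-lightlike regular curve $\alpha:I\to\Sigma^m$. In addition, when this is the case, along every such $\alpha$, for a rotation minimizing frame $\{\alpha',\mathbf{n}_1,\dots,\mathbf{n}_m\}$ along $\alpha$ with curvatures $\kappa_1,\dots,\kappa_m$ and writing $\xi=\sum_{i=1}^m a_i\mathbf{n}_i$ with constants $a_1,\dots,a_m$, one has $$\sum_{i=1}^m\varepsilon\,a_i\kappa_i(s)=\eta\,H(\alpha(s)),$$ where $H$ is the mean curvature of $\Sigma$, $\eta=\langle\xi,\xi\rangle_\nu=\pm1$, and $\varepsilon=\langle\alpha',\alpha'\rangle_\nu=\pm1$.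
   Context: $M_\nu^{m+1}$ is an $(m+1)$-dimensional semi-Riemannian manifold with metric $\langle\cdot,\cdot\rangle_\nu$ of index $\nu$ and Levi-Civita connection $\nabla$. A vector $V\neq0$ is timelike, lightlike or spacelike according to $\langle V,V\rangle_\nu<0$, $=0$, $>0$. Non-lightlike curves and hypersurfaces have the same causal character at all points (a hypersurface is lightlike if its induced metric is degenerate); non-lightlike curves are parametrized so that $\langle\alpha',\alpha'\rangle_\nu=\pm1$. A unit vector field $N$ normal to a non-lightlike curve $\alpha$ minimizes rotation (is RM) along $\alpha$ if $\nabla_{\alpha'}N=\lambda\alpha'$ for some function $\lambda$. An RM frame along $\alpha$ is an orthonormal frame $\{\alpha',\mathbf{n}_1,\dots,\mathbf{n}_m\}$ along $\alpha$ with each $\mathbf{n}_i$ RM; with $\varepsilon_i=\langle\mathbf{n}_i,\mathbf{n}_i\rangle_\nu=\pm1$, its curvatures $\kappa_i$ are defined by $\nabla_{\alpha'}\alpha'=\sum_{i=1}^m\varepsilon_i\kappa_i\mathbf{n}_i$, $\nabla_{\alpha'}\mathbf{n}_i=-\varepsilon\kappa_i\alpha'$. The shape operator is $S_p(X)=-(\nabla_X\xi)(p)$. $\Sigma$ is totally umbilical if at each point every non-lightlike tangent vector is an eigenvector of $S_p$ (equivalently, $S_p$ is a multiple of the identity). The mean curvature is $H=\frac{\eta}{m}\mathrm{tr}(S)$, i.e. $H=\eta\left(\sum_i\lambda_i\right)/m$ where $\lambda_i$ are the eigenvalues of $S$ when it is diagonalizable. *)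

theory Defs
  imports "HOL-Analysis.Analysis"
begin

section \<open>Smooth maps between Euclidean spaces\<close>

text \<open>Intended for open subsets of Euclidean spaces, where being differentiable with all
  directional derivatives of class \<open>C\<^sup>k\<close> is the same as being of class \<open>C\<close> to the \<open>k + 1\<close>.\<close>

primrec Ck_on :: "nat \<Rightarrow> 'a::euclidean_space set \<Rightarrow> ('a \<Rightarrow> 'b::euclidean_space) \<Rightarrow> bool" where
  "Ck_on 0 U f \<longleftrightarrow> continuous_on U f"
| "Ck_on (Suc k) U f \<longleftrightarrow>
     f differentiable_on U \<and> (\<forall>v. Ck_on k U (\<lambda>x. frechet_derivative f (at x) v))"

definition smooth_on :: "'a::euclidean_space set \<Rightarrow> ('a \<Rightarrow> 'b::euclidean_space) \<Rightarrow> bool" where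
  "smooth_on U f \<longleftrightarrow> (\<forall>k. Ck_on k U f)"


section \<open>Smooth manifolds\<close>

text \<open>A chart is a pair of an open domain and a coordinate map; the values of the coordinate map
  off the domain are irrelevant.\<close>

type_synonym ('a, 'n) chart = "'a set \<times> ('a \<Rightarrow> real ^ 'n)"

definition chart_inv :: "('a, 'n::finite) chart \<Rightarrow> real ^ 'n \<Rightarrow> 'a" where
  "chart_inv c = inv_into (fst c) (snd c)"

definition is_chart :: "('a::topological_space, 'n::finite) chart \<Rightarrow> bool" where
  "is_chart c \<longleftrightarrow> open (fst c) \<and> open (snd c ` fst c) \<and>
     homeomorphism (fst c) (snd c ` fst c) (snd c) (chart_inv c)"

definition compatible :: "('a, 'n::finite) chart \<Rightarrow> ('a, 'n) chart \<Rightarrow> bool" where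
  "compatible c d \<longleftrightarrow>
     smooth_on (snd c ` (fst c \<inter> fst d)) (snd d \<circ> chart_inv c) \<and>
     smooth_on (snd d ` (fst c \<inter> fst d)) (snd c \<circ> chart_inv d)"

definition smooth_atlas :: "('a::topological_space, 'n::finite) chart set \<Rightarrow> bool" where
  "smooth_atlas A \<longleftrightarrow> (\<forall>c\<in>A. is_chart c) \<and> (\<Union>c\<in>A. fst c) = UNIV \<and>
     (\<forall>c\<in>A. \<forall>d\<in>A. compatible c d)"

definition max_atlas :: "('a::topological_space, 'n::finite) chart set \<Rightarrow> ('a, 'n) chart set" where
  "max_atlas A = {c. is_chart c \<and> (\<forall>d\<in>A. compatible c d)}"


subsection \<open>Tangent vectors\<close>

text \<open>A tangent vector at \<open>p\<close> is represented by its components in the chart \<open>chart_at A p\<close>, which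
  identifies the tangent space at \<open>p\<close> with the whole of \<open>real ^ 'n\<close>. The choice of this chart is
  immaterial: \<open>chart_transfer c d p\<close> is the change of components at \<open>p\<close> from the chart \<open>c\<close> to the
  chart \<open>d\<close>, and \<open>components A c p v\<close> are the components in \<open>c\<close> of the tangent vector \<open>v\<close> at
  \<open>p\<close>.\<close>

definition chart_at :: "('a, 'n::finite) chart set \<Rightarrow> 'a \<Rightarrow> ('a, 'n) chart" where
  "chart_at A p = (SOME c. c \<in> A \<and> p \<in> fst c)"

definition chart_transfer ::
    "('a, 'n::finite) chart \<Rightarrow> ('a, 'n) chart \<Rightarrow> 'a \<Rightarrow> real ^ 'n \<Rightarrow> real ^ 'n" where
  "chart_transfer c d p = frechet_derivative (snd d \<circ> chart_inv c) (at (snd c p))"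

definition components ::
    "('a, 'n::finite) chart set \<Rightarrow> ('a, 'n) chart \<Rightarrow> 'a \<Rightarrow> real ^ 'n \<Rightarrow> real ^ 'n" where
  "components A c p = chart_transfer (chart_at A p) c p"

definition tangent_of_components ::
    "('a, 'n::finite) chart set \<Rightarrow> ('a, 'n) chart \<Rightarrow> 'a \<Rightarrow> real ^ 'n \<Rightarrow> real ^ 'n" where
  "tangent_of_components A c p = chart_transfer c (chart_at A p) p"


subsection \<open>Curves and vector fields\<close>

definition smooth_curve ::
    "('a::topological_space, 'n::finite) chart set \<Rightarrow> real set \<Rightarrow> (real \<Rightarrow> 'a) \<Rightarrow> bool" where
  "smooth_curve A I \<alpha> \<longleftrightarrow> open I \<and> is_interval I \<and> I \<noteq> {} \<and> continuous_on I \<alpha> \<and>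
     (\<forall>c\<in>A. smooth_on {t \<in> I. \<alpha> t \<in> fst c} (snd c \<circ> \<alpha>))"

definition velocity ::
    "('a, 'n::finite) chart set \<Rightarrow> (real \<Rightarrow> 'a) \<Rightarrow> real \<Rightarrow> real ^ 'n" where
  "velocity A \<alpha> s = vector_derivative (snd (chart_at A (\<alpha> s)) \<circ> \<alpha>) (at s)"

definition smooth_field_along ::
    "('a, 'n::finite) chart set \<Rightarrow> real set \<Rightarrow> (real \<Rightarrow> 'a) \<Rightarrow> (real \<Rightarrow> real ^ 'n) \<Rightarrow> bool" where
  "smooth_field_along A I \<alpha> N \<longleftrightarrow>
     (\<forall>c\<in>A. smooth_on {t \<in> I. \<alpha> t \<in> fst c} (\<lambda>t. components A c (\<alpha> t) (N t)))"

text \<open>Smoothness of a field of tangent vectors of the ambient manifold, defined on a subset \<open>S\<close>: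
  its components extend locally to smooth functions on open sets.\<close>

definition smooth_field_on ::
    "('a::topological_space, 'n::finite) chart set \<Rightarrow> 'a set \<Rightarrow> ('a \<Rightarrow> real ^ 'n) \<Rightarrow> bool" where
  "smooth_field_on A S X \<longleftrightarrow>
     (\<forall>p\<in>S. \<exists>c\<in>A. \<exists>W F. open W \<and> p \<in> W \<and> W \<subseteq> fst c \<and>
        smooth_on (snd c ` W) F \<and> (\<forall>q\<in>W \<inter> S. components A c q (X q) = F (snd c q)))"


section \<open>Semi-Riemannian metrics\<close>

definition form_index :: "'v::euclidean_space set \<Rightarrow> ('v \<Rightarrow> 'v \<Rightarrow> real) \<Rightarrow> nat" where
  "form_index V b =
     Max {dim W | W. subspace W \<and> W \<subseteq> V \<and> (\<forall>w\<in>W. w \<noteq> 0 \<longrightarrow> b w w < 0)}"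

definition nondegenerate_on :: "'v::euclidean_space set \<Rightarrow> ('v \<Rightarrow> 'v \<Rightarrow> real) \<Rightarrow> bool" where
  "nondegenerate_on V b \<longleftrightarrow> (\<forall>v\<in>V. (\<forall>w\<in>V. b v w = 0) \<longrightarrow> v = 0)"

definition metric_in_chart ::
    "('a, 'n::finite) chart set \<Rightarrow> ('a \<Rightarrow> real ^ 'n \<Rightarrow> real ^ 'n \<Rightarrow> real) \<Rightarrow> ('a, 'n) chart \<Rightarrow>
     real ^ 'n \<Rightarrow> real ^ 'n \<Rightarrow> real ^ 'n \<Rightarrow> real" where
  "metric_in_chart A g c x u v =
     (let p = chart_inv c x
      in g p (tangent_of_components A c p u) (tangent_of_components A c p v))"

definition semi_riemannian_manifold ::
    "('a::{t2_space,second_countable_topology}, 'n::finite) chart set \<Rightarrow>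
     ('a \<Rightarrow> real ^ 'n \<Rightarrow> real ^ 'n \<Rightarrow> real) \<Rightarrow> nat \<Rightarrow> bool" where
  "semi_riemannian_manifold A g \<nu> \<longleftrightarrow> smooth_atlas A \<and>
     (\<forall>p. bilinear (g p) \<and> (\<forall>u v. g p u v = g p v u) \<and>
          nondegenerate_on UNIV (g p) \<and> form_index UNIV (g p) = \<nu>) \<and>
     (\<forall>c\<in>A. \<forall>u v. smooth_on (snd c ` fst c) (\<lambda>x. metric_in_chart A g c x u v))"


subsection \<open>The Levi-Civita connection\<close>

text \<open>The Levi-Civita connection \<open>\<nabla>\<close> in a chart: \<open>\<Gamma> u v\<close> are the components at \<open>p\<close> of
  \<open>\<nabla>\<^sub>u v\<close>, where \<open>u\<close> and \<open>v\<close> are vector fields with constant components in the chart. The two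
  conditions that determine \<open>\<Gamma>\<close> uniquely are vanishing torsion and compatibility with the
  metric.\<close>

definition levi_civita ::
    "('a, 'n::finite) chart set \<Rightarrow> ('a \<Rightarrow> real ^ 'n \<Rightarrow> real ^ 'n \<Rightarrow> real) \<Rightarrow> ('a, 'n) chart \<Rightarrow> 'a \<Rightarrow>
     real ^ 'n \<Rightarrow> real ^ 'n \<Rightarrow> real ^ 'n" where
  "levi_civita A g c p = (THE \<Gamma>. bilinear \<Gamma> \<and> (\<forall>u v. \<Gamma> u v = \<Gamma> v u) \<and>
     (\<forall>u v w. frechet_derivative (\<lambda>x. metric_in_chart A g c x v w) (at (snd c p)) u =
        metric_in_chart A g c (snd c p) (\<Gamma> u v) w + metric_in_chart A g c (snd c p) v (\<Gamma> u w)))"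

text \<open>Covariant derivative at parameter \<open>s\<close> of a vector field \<open>N\<close> along a curve \<open>\<alpha>\<close>, computed in
  the chart that represents the tangent vectors at \<open>\<alpha> s\<close>.\<close>

definition cov_deriv_along ::
    "('a, 'n::finite) chart set \<Rightarrow> ('a \<Rightarrow> real ^ 'n \<Rightarrow> real ^ 'n \<Rightarrow> real) \<Rightarrow>
     (real \<Rightarrow> 'a) \<Rightarrow> (real \<Rightarrow> real ^ 'n) \<Rightarrow> real \<Rightarrow> real ^ 'n" where
  "cov_deriv_along A g \<alpha> N s =
     (let c = chart_at A (\<alpha> s)
      in vector_derivative (\<lambda>t. components A c (\<alpha> t) (N t)) (at s) +
         levi_civita A g c (\<alpha> s) (velocity A \<alpha> s) (N s))"

text \<open>Covariant derivative at \<open>p\<close>, in the direction of a vector \<open>v\<close> tangent to the submanifold \<open>S\<close>,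
  of a field \<open>X\<close> that is defined only on \<open>S\<close>. The derivative of the components within the
  coordinate image of \<open>S\<close> is determined on the vectors tangent to \<open>S\<close>.\<close>

definition cov_deriv_on ::
    "('a, 'n::finite) chart set \<Rightarrow> ('a \<Rightarrow> real ^ 'n \<Rightarrow> real ^ 'n \<Rightarrow> real) \<Rightarrow>
     'a set \<Rightarrow> ('a \<Rightarrow> real ^ 'n) \<Rightarrow> 'a \<Rightarrow> real ^ 'n \<Rightarrow> real ^ 'n" where
  "cov_deriv_on A g S X p v =
     (let c = chart_at A p
      in frechet_derivative (\<lambda>x. components A c (chart_inv c x) (X (chart_inv c x)))
           (at (snd c p) within snd c ` (S \<inter> fst c)) v +
         levi_civita A g c p v (X p))"


section \<open>Non-lightlike curves and rotation minimizing frames\<close>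

definition nonlightlike_curve ::
    "('a::topological_space, 'n::finite) chart set \<Rightarrow> ('a \<Rightarrow> real ^ 'n \<Rightarrow> real ^ 'n \<Rightarrow> real) \<Rightarrow>
     real set \<Rightarrow> (real \<Rightarrow> 'a) \<Rightarrow> real \<Rightarrow> bool" where
  "nonlightlike_curve A g I \<alpha> \<epsilon> \<longleftrightarrow> smooth_curve A I \<alpha> \<and> \<epsilon> \<in> {-1, 1} \<and>
     (\<forall>s\<in>I. velocity A \<alpha> s \<noteq> 0 \<and> g (\<alpha> s) (velocity A \<alpha> s) (velocity A \<alpha> s) = \<epsilon>)"

definition minimizes_rotation ::
    "('a, 'n::finite) chart set \<Rightarrow> ('a \<Rightarrow> real ^ 'n \<Rightarrow> real ^ 'n \<Rightarrow> real) \<Rightarrow>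
     real set \<Rightarrow> (real \<Rightarrow> 'a) \<Rightarrow> (real \<Rightarrow> real ^ 'n) \<Rightarrow> bool" where
  "minimizes_rotation A g I \<alpha> N \<longleftrightarrow> smooth_field_along A I \<alpha> N \<and>
     (\<forall>s\<in>I. g (\<alpha> s) (N s) (N s) \<in> {-1, 1} \<and> g (\<alpha> s) (N s) (velocity A \<alpha> s) = 0) \<and>
     (\<exists>l. \<forall>s\<in>I. cov_deriv_along A g \<alpha> N s = l s *\<^sub>R velocity A \<alpha> s)"

text \<open>\<open>{\<alpha>', n 1, \<dots>, n m}\<close> is a rotation minimizing frame along \<open>\<alpha>\<close> with causal characters \<open>e i\<close> of
  the \<open>n i\<close> and curvatures \<open>k i\<close>; it spans the tangent spaces when \<open>CARD('n) = m + 1\<close>.\<close>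

definition rm_frame ::
    "('a, 'n::finite) chart set \<Rightarrow> ('a \<Rightarrow> real ^ 'n \<Rightarrow> real ^ 'n \<Rightarrow> real) \<Rightarrow>
     real set \<Rightarrow> (real \<Rightarrow> 'a) \<Rightarrow> real \<Rightarrow> nat \<Rightarrow>
     (nat \<Rightarrow> real \<Rightarrow> real ^ 'n) \<Rightarrow> (nat \<Rightarrow> real) \<Rightarrow> (nat \<Rightarrow> real \<Rightarrow> real) \<Rightarrow> bool" where
  "rm_frame A g I \<alpha> \<epsilon> m n e k \<longleftrightarrow>
     (\<forall>i\<in>{1..m}. minimizes_rotation A g I \<alpha> (n i) \<and> e i \<in> {-1, 1}) \<and>
     (\<forall>s\<in>I. \<forall>i\<in>{1..m}. \<forall>j\<in>{1..m}. g (\<alpha> s) (n i s) (n j s) = (if i = j then e i else 0)) \<and>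
     (\<forall>s\<in>I. cov_deriv_along A g \<alpha> (velocity A \<alpha>) s = (\<Sum>i=1..m. (e i * k i s) *\<^sub>R n i s)) \<and>
     (\<forall>s\<in>I. \<forall>i\<in>{1..m}. cov_deriv_along A g \<alpha> (n i) s = (- \<epsilon> * k i s) *\<^sub>R velocity A \<alpha> s)"


section \<open>Hypersurfaces\<close>

text \<open>Embedded submanifolds of codimension one, described by slice charts.\<close>

definition hypersurface :: "('a::topological_space, 'n::finite) chart set \<Rightarrow> 'a set \<Rightarrow> bool" where
  "hypersurface A S \<longleftrightarrow> (\<forall>p\<in>S. \<exists>c\<in>max_atlas A. \<exists>k. p \<in> fst c \<and>
     snd c ` (S \<inter> fst c) = {x \<in> snd c ` fst c. x $ k = 0})"

definition tangent_space ::
    "('a::topological_space, 'n::finite) chart set \<Rightarrow> 'a set \<Rightarrow> 'a \<Rightarrow> (real ^ 'n) set" where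
  "tangent_space A S p = {velocity A \<beta> 0 | \<beta> I.
     smooth_curve A I \<beta> \<and> 0 \<in> I \<and> \<beta> ` I \<subseteq> S \<and> \<beta> 0 = p}"

text \<open>The induced metric is nondegenerate and has the same index at all points.\<close>

definition nonlightlike_hypersurface ::
    "('a::topological_space, 'n::finite) chart set \<Rightarrow> ('a \<Rightarrow> real ^ 'n \<Rightarrow> real ^ 'n \<Rightarrow> real) \<Rightarrow>
     'a set \<Rightarrow> bool" where
  "nonlightlike_hypersurface A g S \<longleftrightarrow> hypersurface A S \<and>
     (\<forall>p\<in>S. nondegenerate_on (tangent_space A S p) (g p)) \<and>
     (\<exists>\<mu>. \<forall>p\<in>S. form_index (tangent_space A S p) (g p) = \<mu>)"

text \<open>A hypersurface is orientable, in the sense of having an orientable normal bundle, exactly if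
  it admits such a field.\<close>

definition unit_normal_field ::
    "('a::topological_space, 'n::finite) chart set \<Rightarrow> ('a \<Rightarrow> real ^ 'n \<Rightarrow> real ^ 'n \<Rightarrow> real) \<Rightarrow>
     'a set \<Rightarrow> ('a \<Rightarrow> real ^ 'n) \<Rightarrow> real \<Rightarrow> bool" where
  "unit_normal_field A g S \<xi> \<eta> \<longleftrightarrow> smooth_field_on A S \<xi> \<and> \<eta> \<in> {-1, 1} \<and>
     (\<forall>p\<in>S. g p (\<xi> p) (\<xi> p) = \<eta> \<and> (\<forall>v\<in>tangent_space A S p. g p (\<xi> p) v = 0))"

definition shape_operator ::
    "('a, 'n::finite) chart set \<Rightarrow> ('a \<Rightarrow> real ^ 'n \<Rightarrow> real ^ 'n \<Rightarrow> real) \<Rightarrow>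
     'a set \<Rightarrow> ('a \<Rightarrow> real ^ 'n) \<Rightarrow> 'a \<Rightarrow> real ^ 'n \<Rightarrow> real ^ 'n" where
  "shape_operator A g S \<xi> p v = - cov_deriv_on A g S \<xi> p v"

definition totally_umbilical ::
    "('a::topological_space, 'n::finite) chart set \<Rightarrow> ('a \<Rightarrow> real ^ 'n \<Rightarrow> real ^ 'n \<Rightarrow> real) \<Rightarrow>
     'a set \<Rightarrow> ('a \<Rightarrow> real ^ 'n) \<Rightarrow> bool" where
  "totally_umbilical A g S \<xi> \<longleftrightarrow>
     (\<forall>p\<in>S. \<forall>v\<in>tangent_space A S p. g p v v \<noteq> 0 \<longrightarrow>
        (\<exists>l. shape_operator A g S \<xi> p v = l *\<^sub>R v))"

text \<open>Trace of a linear endomorphism \<open>f\<close> of a subspace \<open>V\<close>; it does not depend on the basis.\<close>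

definition trace_on :: "'v::euclidean_space set \<Rightarrow> ('v \<Rightarrow> 'v) \<Rightarrow> real" where
  "trace_on V f =
     (let B = (SOME B. independent B \<and> span B = V) in \<Sum>b\<in>B. representation B (f b) b)"

definition mean_curvature ::
    "('a::topological_space, 'n::finite) chart set \<Rightarrow> ('a \<Rightarrow> real ^ 'n \<Rightarrow> real ^ 'n \<Rightarrow> real) \<Rightarrow>
     'a set \<Rightarrow> ('a \<Rightarrow> real ^ 'n) \<Rightarrow> real \<Rightarrow> nat \<Rightarrow> 'a \<Rightarrow> real" where
  "mean_curvature A g S \<xi> \<eta> m p =
     \<eta> / real m * trace_on (tangent_space A S p) (shape_operator A g S \<xi> p)"

end

theory Submission
  imports Defs
begin

text \<open>Along a curve \<open>\<alpha>\<close> in \<open>S\<close> the covariant derivative of \<open>\<xi> \<circ> \<alpha>\<close> is minus the shape operator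
  applied to \<open>\<alpha>'\<close>, so \<open>\<xi>\<close> minimizes rotation along \<open>\<alpha>\<close> exactly if each \<open>\<alpha>'\<close> is an eigenvector;
  conversely every tangent vector that is not lightlike is, up to scaling, the velocity of a curve
  in \<open>S\<close> of unit speed. If \<open>S\<close> is totally umbilical, its shape operator at \<open>p\<close> is a multiple
  \<open>l\<close> of the identity, since a nondegenerate form has enough non-null vectors to force
  a common eigenvalue; hence \<open>l = \<eta> H\<close>. By compatibility of the connection with the metric,
  the products of \<open>\<xi>\<close> with the vectors of a rotation minimizing frame are constant,
  and differentiating the product of \<open>\<xi>\<close> with \<open>\<alpha>'\<close>, which is zero, gives the formula for the
  curvatures.\<close>

section \<open>Calculus of smooth maps\<close>

text \<open>Several notions are descriptions or arbitrary choices: the connection is a definite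
  description, the trace uses some basis, and the derivative behind the shape operator is some
  derivative within the coordinate image of \<open>S\<close>, which is not determined transversally
  to \<open>S\<close>. The shape operator is therefore a linear map of the whole ambient space whose
  values are meaningful only on tangent vectors, and the eigenvalue argument uses nothing but its
  linearity and its values there.

  The second obstacle is the normalization of curves. Tangent vectors are velocities of arbitrary
  smooth curves, whereas rotation is tested on unit speed curves, so the reparametrization must be
  shown smooth; this comes from the differential equation solved by the inverse of arc length.

  The signs come from \<eta>, \<epsilon> and \<open>e i\<close> all having square 1: this yields l =
  \<eta> H from H = \<eta> l, the coefficients a_i = e_i <\<xi>, n_i>, and the factor \<epsilon> in
  the final formula.\<close>

lemma linear_basis_expansion:
  fixes f :: "'a::euclidean_space \<Rightarrow> 'b::real_vector"
  assumes "linear f"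
  shows "f w = (\<Sum>b\<in>Basis. (w \<bullet> b) *\<^sub>R f b)"
proof -
  have "f w = f (\<Sum>b\<in>Basis. (w \<bullet> b) *\<^sub>R b)" by (simp add: euclidean_representation)
  also have "\<dots> = (\<Sum>b\<in>Basis. (w \<bullet> b) *\<^sub>R f b)"
    by (simp add: linear_sum[OF assms] linear_scale[OF assms])
  finally show ?thesis .
qed

lemma Ck_on_subset: "Ck_on k U f \<Longrightarrow> V \<subseteq> U \<Longrightarrow> Ck_on k V f"
  by (induction k arbitrary: f) (auto intro: continuous_on_subset differentiable_on_subset)

text \<open>Since \<open>frechet_derivative\<close> is a choice operator, inductions on the order
  are easier when any explicit family of derivatives may be exhibited in its place; on open sets the
  two are interchangeable.\<close>

lemma Ck_on_Suc_open:
  assumes "open U"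
  shows "Ck_on (Suc k) U f \<longleftrightarrow>
    (\<exists>f'. (\<forall>x\<in>U. (f has_derivative f' x) (at x)) \<and> (\<forall>v. Ck_on k U (\<lambda>x. f' x v)))"
    (is "_ \<longleftrightarrow> ?R")
  and Ck_on_cong_open: "(\<And>x. x \<in> U \<Longrightarrow> f x = h x) \<Longrightarrow> Ck_on k U f \<longleftrightarrow> Ck_on k U h"
proof -
  \<comment> \<open>Stated for all maps and orders because it serves both claims; in the first one
    it replaces a given family of derivatives by \<open>frechet_derivative\<close>. Openness of
    \<open>U\<close> is what makes the values on \<open>U\<close> decide the derivative at its
    points.\<close>
  have cong: "(\<And>x. x \<in> U \<Longrightarrow> f x = h x) \<Longrightarrow> Ck_on k U f \<Longrightarrow> Ck_on k U h" for f h :: "'a \<Rightarrow> 'b" and k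
  proof (induction k arbitrary: f h)
    case 0
    then show ?case using continuous_on_cong by fastforce
  next
    case (Suc k)
    have 1: "h differentiable_on U"
      using Suc.prems differentiable_transform_within[of f _ U 1 h]
      by (auto simp: differentiable_on_def)
    have 2: "frechet_derivative f (at x) = frechet_derivative h (at x)" if "x \<in> U" for x
    proof -
      have "(f has_derivative D) (at x) \<longleftrightarrow> (h has_derivative D) (at x)" for D
        using that assms Suc.prems(1) by (metis has_derivative_transform_within_open)
      then show ?thesis by (simp add: frechet_derivative_def)
    qed
    have "Ck_on k U (\<lambda>x. frechet_derivative h (at x) v)" for v
      by (rule Suc.IH[of "\<lambda>x. frechet_derivative f (at x) v"]) (use Suc.prems 2 in auto)
    with 1 show ?case by simp
  qed
  then show "(\<And>x. x \<in> U \<Longrightarrow> f x = h x) \<Longrightarrow> Ck_on k U f \<longleftrightarrow> Ck_on k U h"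
    by (metis (no_types, lifting))
  show "Ck_on (Suc k) U f \<longleftrightarrow> ?R"
  proof
    assume "Ck_on (Suc k) U f"
    then show ?R
      by (intro exI[of _ "\<lambda>x. frechet_derivative f (at x)"])
         (use assms in \<open>auto simp: differentiable_on_def frechet_derivative_works
              at_within_open_NO_MATCH\<close>)
  next
    assume ?R
    then obtain f' where f': "\<And>x. x \<in> U \<Longrightarrow> (f has_derivative f' x) (at x)"
      "\<And>v. Ck_on k U (\<lambda>x. f' x v)" by auto
    have "Ck_on k U (\<lambda>x. frechet_derivative f (at x) v)" for v
      by (rule cong[OF _ f'(2)[of v]]) (simp add: frechet_derivative_at[OF f'(1), symmetric])
    moreover have "f differentiable_on U"
      using f'(1) by (auto simp: differentiable_on_def differentiable_def intro: has_derivative_at_withinI)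
    ultimately show "Ck_on (Suc k) U f" by simp
  qed
qed

lemma Ck_on_SucE:
  assumes "open U" "Ck_on (Suc k) U f"
  obtains f' where "\<And>x. x \<in> U \<Longrightarrow> (f has_derivative f' x) (at x)"
    "\<And>v. Ck_on k U (\<lambda>x. f' x v)"
  using assms(2) that unfolding Ck_on_Suc_open[OF assms(1)] by blast

lemma Ck_on_SucD: "open U \<Longrightarrow> Ck_on (Suc k) U f \<Longrightarrow> Ck_on k U f"
proof (induction k arbitrary: f)
  case 0
  then show ?case by (simp add: differentiable_imp_continuous_on)
next
  case (Suc k)
  then show ?case by simp
qed

text \<open>The derivative in \<open>Ck_on\<close> is taken at \<open>x\<close> and not within the
  set, so it is the same function for every neighbourhood and the induction never has to compare
  derivatives.\<close>

lemma Ck_on_local: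
  assumes "\<And>x. x \<in> U \<Longrightarrow> \<exists>V. open V \<and> x \<in> V \<and> Ck_on k V f"
  shows "Ck_on k U f"
  using assms
proof (induction k arbitrary: f)
  case 0
  then show ?case
    by (auto simp: continuous_on_eq_continuous_within)
       (metis at_within_open continuous_at_imp_continuous_within)
next
  case (Suc k)
  have "f differentiable_on U"
    using Suc.prems by (auto simp: differentiable_on_def)
      (metis at_within_open differentiable_at_withinI)
  moreover have "Ck_on k U (\<lambda>x. frechet_derivative f (at x) v)" for v
  proof (rule Suc.IH)
    fix x assume "x \<in> U"
    then obtain V where "open V" "x \<in> V" "Ck_on (Suc k) V f" using Suc.prems by blast
    then show "\<exists>V. open V \<and> x \<in> V \<and> Ck_on k V (\<lambda>x. frechet_derivative f (at x) v)"
      by (intro exI[of _ V]) simp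
  qed
  ultimately show ?case by simp
qed

lemma Ck_on_const: "Ck_on k U (\<lambda>x. c)"
  by (induction k arbitrary: c) auto

lemma Ck_on_bounded_linear:
  assumes "bounded_linear h" "open U" "Ck_on k U f"
  shows "Ck_on k U (\<lambda>x. h (f x))"
  using assms(3)
proof (induction k arbitrary: f)
  case 0
  then show ?case using assms by (auto intro: bounded_linear.continuous_on)
next
  case (Suc k)
  obtain f' where f': "\<And>x. x \<in> U \<Longrightarrow> (f has_derivative f' x) (at x)"
    "\<And>v. Ck_on k U (\<lambda>x. f' x v)" by (rule Ck_on_SucE[OF assms(2) Suc.prems]) blast
  show ?case unfolding Ck_on_Suc_open[OF assms(2)]
    using f' Suc.IH by (intro exI[of _ "\<lambda>x v. h (f' x v)"])
      (auto intro: bounded_linear.has_derivative[OF assms(1)])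
qed

lemma Ck_on_id: "Ck_on k U (\<lambda>x. x)"
proof (cases k)
  case (Suc k')
  have "Ck_on k' U (\<lambda>x. frechet_derivative (\<lambda>x. x) (at x) v)" for v :: 'a
    by (simp add: Ck_on_const)
  then show ?thesis using Suc by simp
qed (simp)

lemma Ck_on_add:
  assumes "open U" "Ck_on k U f" "Ck_on k U h"
  shows "Ck_on k U (\<lambda>x. f x + h x)"
  using assms(2,3)
proof (induction k arbitrary: f h)
  case 0
  then show ?case by (auto intro: continuous_on_add)
next
  case (Suc k)
  obtain f' where f': "\<And>x. x \<in> U \<Longrightarrow> (f has_derivative f' x) (at x)"
    "\<And>v. Ck_on k U (\<lambda>x. f' x v)" by (rule Ck_on_SucE[OF assms(1) Suc.prems(1)]) blast
  obtain h' where h': "\<And>x. x \<in> U \<Longrightarrow> (h has_derivative h' x) (at x)"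
    "\<And>v. Ck_on k U (\<lambda>x. h' x v)" by (rule Ck_on_SucE[OF assms(1) Suc.prems(2)]) blast
  show ?case unfolding Ck_on_Suc_open[OF assms(1)]
    using f' h' Suc.IH by (intro exI[of _ "\<lambda>x v. f' x v + h' x v"])
      (auto intro: has_derivative_add)
qed

lemma Ck_on_sum:
  assumes "open U" "\<And>i. i \<in> J \<Longrightarrow> Ck_on k U (f i)"
  shows "Ck_on k U (\<lambda>x. \<Sum>i\<in>J. f i x)"
  using assms(2)
  by (induction J rule: infinite_finite_induct) (auto simp: Ck_on_const intro!: Ck_on_add assms(1))

lemma Ck_on_bilinear:
  assumes "bounded_bilinear b" "open U" "Ck_on k U f" "Ck_on k U h"
  shows "Ck_on k U (\<lambda>x. b (f x) (h x))"
  using assms(3,4)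
proof (induction k arbitrary: f h)
  case 0
  then show ?case by (auto intro: bounded_bilinear.continuous_on[OF assms(1)])
next
  case (Suc k)
  obtain f' where f': "\<And>x. x \<in> U \<Longrightarrow> (f has_derivative f' x) (at x)"
    "\<And>v. Ck_on k U (\<lambda>x. f' x v)" by (rule Ck_on_SucE[OF assms(2) Suc.prems(1)]) blast
  obtain h' where h': "\<And>x. x \<in> U \<Longrightarrow> (h has_derivative h' x) (at x)"
    "\<And>v. Ck_on k U (\<lambda>x. h' x v)" by (rule Ck_on_SucE[OF assms(2) Suc.prems(2)]) blast
  show ?case unfolding Ck_on_Suc_open[OF assms(2)]
    using f' h' Suc.IH Suc.prems[THEN Ck_on_SucD[OF assms(2)]]
    by (intro exI[of _ "\<lambda>x v. b (f x) (h' x v) + b (f' x v) (h x)"])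
      (auto intro!: Ck_on_add assms(2) bounded_bilinear.FDERIV[OF assms(1)])
qed

text \<open>In the chain rule the linear map \<open>f' (h x)\<close> varies with \<open>x\<close> as
  well as its argument. Expanding the argument in a basis turns the derivative into a sum of
  products; the factors \<open>f' (h x) b\<close> are again compositions with \<open>h\<close>, so
  the induction generalizes over \<open>f\<close> only.\<close>

lemma Ck_on_compose:
  assumes "open U" "open V" "Ck_on k V f" "Ck_on k U h" "\<And>x. x \<in> U \<Longrightarrow> h x \<in> V"
  shows "Ck_on k U (\<lambda>x. f (h x))"
  using assms(3,4)
proof (induction k arbitrary: f)
  case 0
  then show ?case using assms by (auto intro: continuous_on_compose2)
next
  case (Suc k)
  obtain f' where f': "\<And>x. x \<in> V \<Longrightarrow> (f has_derivative f' x) (at x)"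
    "\<And>v. Ck_on k V (\<lambda>x. f' x v)" by (rule Ck_on_SucE[OF assms(2) Suc.prems(1)]) blast
  obtain h' where h': "\<And>x. x \<in> U \<Longrightarrow> (h has_derivative h' x) (at x)"
    "\<And>v. Ck_on k U (\<lambda>x. h' x v)" by (rule Ck_on_SucE[OF assms(1) Suc.prems(2)]) blast
  have 1: "((\<lambda>x. f (h x)) has_derivative (\<lambda>v. f' (h x) (h' x v))) (at x)" if "x \<in> U" for x
    using has_derivative_compose[OF h'(1)[OF that] f'(1)] assms(5) that by simp
  have 2: "f' y w = (\<Sum>b\<in>Basis. (w \<bullet> b) *\<^sub>R f' y b)" if "y \<in> V" for y w
    by (rule linear_basis_expansion[OF has_derivative_linear[OF f'(1)[OF that]]])
  have 3: "Ck_on k U (\<lambda>x. f' (h x) b)" for b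
    using Suc.IH[of "\<lambda>y. f' y b"] f'(2) Suc.prems(2) Ck_on_SucD[OF assms(1)] by blast
  have "Ck_on k U (\<lambda>x. \<Sum>b\<in>Basis. (h' x v \<bullet> b) *\<^sub>R f' (h x) b)" for v
    by (intro Ck_on_sum assms(1) Ck_on_bilinear[OF bounded_bilinear_scaleR] 3
        Ck_on_bounded_linear[OF bounded_linear_inner_left] h'(2))
  then have "Ck_on k U (\<lambda>x. f' (h x) (h' x v))" for v
    using Ck_on_cong_open[OF assms(1), of "\<lambda>x. f' (h x) (h' x v)"
      "\<lambda>x. \<Sum>b\<in>Basis. (h' x v \<bullet> b) *\<^sub>R f' (h x) b" k] 2 assms(5) by simp
  with 1 show ?case unfolding Ck_on_Suc_open[OF assms(1)]
    by (intro exI[of _ "\<lambda>x v. f' (h x) (h' x v)"]) auto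
qed

section \<open>Closure properties of smooth maps\<close>

lemma smooth_on_subset: "smooth_on U f \<Longrightarrow> V \<subseteq> U \<Longrightarrow> smooth_on V f"
  by (auto simp: smooth_on_def intro: Ck_on_subset)

lemma smooth_on_cong:
  "open U \<Longrightarrow> smooth_on U f \<Longrightarrow> (\<And>x. x \<in> U \<Longrightarrow> f x = h x) \<Longrightarrow> smooth_on U h"
  using Ck_on_cong_open[of U f h] by (auto simp: smooth_on_def)

lemma smooth_on_local:
  "(\<And>x. x \<in> U \<Longrightarrow> \<exists>V. open V \<and> x \<in> V \<and> smooth_on V f) \<Longrightarrow> smooth_on U f"
  unfolding smooth_on_def by (metis Ck_on_local)

lemma smooth_on_const: "smooth_on U (\<lambda>x. c)"
  and smooth_on_id: "smooth_on U (\<lambda>x. x)"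
  by (auto simp: smooth_on_def Ck_on_const Ck_on_id)

lemma smooth_on_bounded_linear:
  "bounded_linear h \<Longrightarrow> open U \<Longrightarrow> smooth_on U f \<Longrightarrow> smooth_on U (\<lambda>x. h (f x))"
  by (auto simp: smooth_on_def Ck_on_bounded_linear)

lemma smooth_on_add:
  "open U \<Longrightarrow> smooth_on U f \<Longrightarrow> smooth_on U h \<Longrightarrow> smooth_on U (\<lambda>x. f x + h x)"
  by (auto simp: smooth_on_def Ck_on_add)

lemma smooth_on_sum:
  "open U \<Longrightarrow> (\<And>i. i \<in> J \<Longrightarrow> smooth_on U (f i)) \<Longrightarrow> smooth_on U (\<lambda>x. \<Sum>i\<in>J. f i x)"
  by (auto simp: smooth_on_def Ck_on_sum)

lemma smooth_on_scaleR:
  "open U \<Longrightarrow> smooth_on U f \<Longrightarrow> smooth_on U h \<Longrightarrow> smooth_on U (\<lambda>x. f x *\<^sub>R h x)"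
  by (auto simp: smooth_on_def Ck_on_bilinear[OF bounded_bilinear_scaleR])

lemma smooth_on_compose:
  "smooth_on V f \<Longrightarrow> smooth_on U h \<Longrightarrow> open U \<Longrightarrow> open V \<Longrightarrow> (\<And>x. x \<in> U \<Longrightarrow> h x \<in> V) \<Longrightarrow>
    smooth_on U (\<lambda>x. f (h x))"
  unfolding smooth_on_def by (metis Ck_on_compose)

lemma smooth_on_frechet_derivative:
  "smooth_on U f \<Longrightarrow> smooth_on U (\<lambda>x. frechet_derivative f (at x) v)"
  unfolding smooth_on_def by (metis Ck_on.simps(2))

lemma smooth_on_imp_has_derivative:
  assumes "smooth_on U f" "open U" "x \<in> U"
  shows "(f has_derivative frechet_derivative f (at x)) (at x)"
proof -
  have "f differentiable_on U" using assms(1) unfolding smooth_on_def by (metis Ck_on.simps(2))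
  then show ?thesis
    using assms by (simp add: differentiable_on_def at_within_open_NO_MATCH frechet_derivative_works)
qed

text \<open>A field of linear maps needs to be tested on constant vectors only. This covers both the
  Jacobians of coordinate changes and the coefficients of the metric.\<close>

lemma smooth_on_linear_family:
  fixes L :: "'a::euclidean_space \<Rightarrow> 'b::euclidean_space \<Rightarrow> 'c::euclidean_space"
  assumes "open U" "\<And>x. x \<in> U \<Longrightarrow> linear (L x)" "\<And>b. smooth_on U (\<lambda>x. L x b)" "smooth_on U h"
  shows "smooth_on U (\<lambda>x. L x (h x))"
proof -
  have "smooth_on U (\<lambda>x. \<Sum>b\<in>Basis. (h x \<bullet> b) *\<^sub>R L x b)"
    by (intro smooth_on_sum smooth_on_scaleR smooth_on_bounded_linear[OF bounded_linear_inner_left]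
        assms)
  moreover have "(\<Sum>b\<in>Basis. (h x \<bullet> b) *\<^sub>R L x b) = L x (h x)" if "x \<in> U" for x
    using linear_basis_expansion[OF assms(2)[OF that], of "h x"] by simp
  ultimately show ?thesis by (rule smooth_on_cong[OF assms(1)])
qed

lemma smooth_on_has_vector_derivative:
  fixes f :: "real \<Rightarrow> 'b::euclidean_space"
  assumes "smooth_on U f" "open U" "t \<in> U"
  shows "(f has_vector_derivative vector_derivative f (at t)) (at t)"
proof -
  have "f differentiable at t"
    using smooth_on_imp_has_derivative[OF assms] differentiableI by blast
  then show ?thesis by (simp add: vector_derivative_works)
qed

lemma smooth_on_vector_derivative:
  fixes f :: "real \<Rightarrow> 'b::euclidean_space"
  assumes "smooth_on U f" "open U"
  shows "smooth_on U (\<lambda>t. vector_derivative f (at t))"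
proof (rule smooth_on_cong[OF assms(2) smooth_on_frechet_derivative[OF assms(1), of 1]])
  fix t assume "t \<in> U"
  then have "(f has_derivative (\<lambda>x. x *\<^sub>R vector_derivative f (at t))) (at t)"
    using smooth_on_has_vector_derivative[OF assms] by (simp add: has_vector_derivative_def)
  from frechet_derivative_at[OF this, symmetric]
  show "frechet_derivative f (at t) 1 = vector_derivative f (at t)" by simp
qed

text \<open>Bootstrapping: if \<phi> is of class C^k, then so is its derivative G(\<phi>), hence
  \<phi> is of class C^(k+1). This is how the inverse of arc length is seen to be smooth.\<close>

lemma smooth_on_autonomous_ode:
  fixes \<phi> G :: "real \<Rightarrow> real"
  assumes "open J" "open K" "smooth_on K G" "\<And>s. s \<in> J \<Longrightarrow> \<phi> s \<in> K"
    "\<And>s. s \<in> J \<Longrightarrow> (\<phi> has_real_derivative G (\<phi> s)) (at s)"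
  shows "smooth_on J \<phi>"
proof -
  have "Ck_on k J \<phi>" for k
  proof (induction k)
    case 0
    then show ?case
      using assms(5) by (auto intro!: continuous_at_imp_continuous_on DERIV_isCont)
  next
    case (Suc k)
    have "Ck_on k J (\<lambda>s. G (\<phi> s))"
      by (rule Ck_on_compose[OF assms(1,2) _ Suc assms(4)])
        (use assms(3) in \<open>simp_all add: smooth_on_def\<close>)
    then have "Ck_on k J (\<lambda>s. G (\<phi> s) * v)" for v
      by (intro Ck_on_bilinear[OF bounded_bilinear_mult] Ck_on_const assms(1))
    then show ?case unfolding Ck_on_Suc_open[OF assms(1)] using assms(5)
      by (intro exI[of _ "\<lambda>s v. G (\<phi> s) * v"]) (auto simp: has_field_derivative_def)
  qed
  then show ?thesis by (simp add: smooth_on_def)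
qed

text \<open>Differentiation lowers the exponent by one, so the induction runs over all exponents at
  once. The exponents 1/2 and -1/2 will give the speed of a curve and its reciprocal.\<close>

lemma smooth_on_powr: "smooth_on {0<..} (\<lambda>x::real. x powr a)"
proof -
  have "Ck_on k {0<..} (\<lambda>x::real. x powr a)" for k
  proof (induction k arbitrary: a)
    case 0
    then show ?case by (auto intro!: continuous_intros)
  next
    case (Suc k)
    have "Ck_on k {0<..} (\<lambda>x::real. (a * x powr (a - 1)) * v)" for v
      by (intro Ck_on_bilinear[OF bounded_bilinear_mult] Ck_on_const Suc) auto
    moreover have "((\<lambda>x::real. x powr a) has_derivative (\<lambda>v. (a * x powr (a - 1)) * v)) (at x)"
      if "x > 0" for x
      using has_real_derivative_powr[OF that, of a] by (simp add: has_field_derivative_def)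
    ultimately show ?case unfolding Ck_on_Suc_open[OF open_greaterThan]
      by (intro exI[of _ "\<lambda>x v. (a * x powr (a - 1)) * v"]) auto
  qed
  then show ?thesis by (simp add: smooth_on_def)
qed


section \<open>Charts, curves and vector fields\<close>

lemma chart_inv_inverse:
  assumes "is_chart c"
  shows chart_inv_apply: "p \<in> fst c \<Longrightarrow> chart_inv c (snd c p) = p"
    and chart_apply_inv: "x \<in> snd c ` fst c \<Longrightarrow> snd c (chart_inv c x) = x"
    and chart_inv_in: "x \<in> snd c ` fst c \<Longrightarrow> chart_inv c x \<in> fst c"
  using assms by (auto simp: is_chart_def homeomorphism_def)

lemma open_chart_image:
  assumes "is_chart c" "open V" "V \<subseteq> fst c"
  shows "open (snd c ` V)"
proof -
  have "openin (top_of_set (snd c ` fst c)) (snd c ` V)"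
    using homeomorphism_imp_open_map[of "fst c" "snd c ` fst c" "snd c" "chart_inv c" V] assms
    by (simp add: is_chart_def open_subset)
  then show ?thesis using assms(1) by (metis is_chart_def openin_open_eq)
qed

lemma compatible_sym: "compatible c d \<Longrightarrow> compatible d c"
  by (auto simp: compatible_def Int_commute)

lemma open_overlap: "is_chart c \<Longrightarrow> is_chart d \<Longrightarrow> open (snd c ` (fst c \<inter> fst d))"
  by (intro open_chart_image) (auto simp: is_chart_def)

lemma transition_has_derivative:
  assumes "is_chart c" "is_chart d" "compatible c d" "p \<in> fst c" "p \<in> fst d"
  shows "((snd d \<circ> chart_inv c) has_derivative chart_transfer c d p) (at (snd c p))"
  unfolding chart_transfer_def
  by (rule smooth_on_imp_has_derivative[OF _ open_overlap[OF assms(1,2)]])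
    (use assms in \<open>auto simp: compatible_def\<close>)

lemma linear_chart_transfer:
  "is_chart c \<Longrightarrow> is_chart d \<Longrightarrow> compatible c d \<Longrightarrow> p \<in> fst c \<Longrightarrow> p \<in> fst d \<Longrightarrow>
    linear (chart_transfer c d p)"
  using transition_has_derivative has_derivative_linear by blast

lemma chart_transfer_refl:
  assumes "is_chart c" "p \<in> fst c"
  shows "chart_transfer c c p v = v"
proof -
  have "((snd c \<circ> chart_inv c) has_derivative (\<lambda>v. v)) (at (snd c p))"
    by (rule has_derivative_transform_within_open[OF has_derivative_ident, of "snd c ` fst c"])
      (use assms chart_apply_inv[OF assms(1)] in \<open>auto simp: is_chart_def\<close>)
  from frechet_derivative_at[OF this, symmetric] show ?thesis by (simp add: chart_transfer_def)
qed

lemma chart_transfer_trans: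
  assumes "is_chart c" "is_chart d" "is_chart e" "compatible c d" "compatible d e"
    "p \<in> fst c" "p \<in> fst d" "p \<in> fst e"
  shows "chart_transfer d e p (chart_transfer c d p v) = chart_transfer c e p v"
proof -
  have 0: "(snd d \<circ> chart_inv c) (snd c p) = snd d p"
    by (simp add: chart_inv_apply[OF assms(1,6)])
  have 1: "((snd e \<circ> chart_inv d) \<circ> (snd d \<circ> chart_inv c) has_derivative
      chart_transfer d e p \<circ> chart_transfer c d p) (at (snd c p))"
    using diff_chain_at[OF transition_has_derivative[of c d p], of "snd e \<circ> chart_inv d"
        "chart_transfer d e p"] transition_has_derivative[of d e p] assms 0 by simp
  have "open (snd c ` (fst c \<inter> fst d))" using open_overlap assms by blast
  then have "((snd e \<circ> chart_inv c) has_derivative chart_transfer d e p \<circ> chart_transfer c d p)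
      (at (snd c p))"
    by (rule has_derivative_transform_within_open[OF 1])
      (use assms chart_inv_apply[OF assms(1)] chart_inv_apply[OF assms(2)] in auto)
  from frechet_derivative_at[OF this] show ?thesis
    by (metis chart_transfer_def comp_apply)
qed

lemma chart_transfer_inverse:
  assumes "is_chart c" "is_chart d" "compatible c d" "p \<in> fst c" "p \<in> fst d"
  shows "chart_transfer d c p (chart_transfer c d p v) = v"
  using chart_transfer_trans[OF assms(1,2,1,3) compatible_sym[OF assms(3)]] chart_transfer_refl assms
  by simp

lemma smooth_on_chart_transfer:
  assumes "is_chart c" "is_chart d" "compatible c d"
  shows "smooth_on (snd c ` (fst c \<inter> fst d)) (\<lambda>x. chart_transfer c d (chart_inv c x) v)"
proof (rule smooth_on_cong[OF open_overlap[OF assms(1,2)]])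
  show "smooth_on (snd c ` (fst c \<inter> fst d)) (\<lambda>x. frechet_derivative (snd d \<circ> chart_inv c) (at x) v)"
    using assms by (intro smooth_on_frechet_derivative) (simp add: compatible_def)
qed (use chart_inv_apply[OF assms(1)] in \<open>auto simp: chart_transfer_def\<close>)

text \<open>Continuity of \<alpha> keeps it in the domain of \<open>c\<close> near \<open>s\<close>,
  where its expression in \<open>d\<close> factors through its expression in \<open>c\<close>; the
  rest is the chain rule.\<close>

lemma vector_derivative_transfer:
  assumes "is_chart c" "is_chart d" "compatible c d" "open I" "continuous_on I \<alpha>" "s \<in> I"
    "\<alpha> s \<in> fst c" "\<alpha> s \<in> fst d" "((snd c \<circ> \<alpha>) has_vector_derivative v) (at s)"
  shows "((snd d \<circ> \<alpha>) has_vector_derivative chart_transfer c d (\<alpha> s) v) (at s)"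
proof -
  have 1: "((snd d \<circ> chart_inv c) \<circ> (snd c \<circ> \<alpha>) has_vector_derivative chart_transfer c d (\<alpha> s) v)
      (at s)"
    by (rule vector_derivative_diff_chain_within[OF assms(9)], rule has_derivative_at_withinI)
      (use transition_has_derivative[OF assms(1-3,7,8)] in \<open>simp add: comp_def\<close>)
  have "open {t \<in> I. \<alpha> t \<in> fst c}"
    using continuous_open_preimage[OF assms(5,4), of "fst c"] assms(1)
    by (simp add: is_chart_def vimage_def Int_def)
  then show ?thesis
    by (rule has_vector_derivative_transform_within_open[OF 1])
      (use assms chart_inv_apply[OF assms(1)] in auto)
qed

lemma open_curve_domain:
  "smooth_curve A I \<alpha> \<Longrightarrow> open W \<Longrightarrow> open {t \<in> I. \<alpha> t \<in> W}"
  using continuous_open_preimage[of I \<alpha> W] by (simp add: smooth_curve_def vimage_def Int_def)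

lemma max_atlasD:
  "c \<in> max_atlas A \<Longrightarrow> is_chart c" "c \<in> max_atlas A \<Longrightarrow> d \<in> A \<Longrightarrow> compatible c d"
  by (auto simp: max_atlas_def)

context
  fixes A :: "('a::topological_space, 'n::finite) chart set"
  assumes atlas: "smooth_atlas A"
begin

text \<open>Slice charts of a hypersurface come from \<open>max_atlas A\<close>, while the charts
  that represent tangent vectors come from \<open>A\<close>. Facts stated for
  \<open>max_atlas A\<close> cover both through this inclusion.\<close>

lemma atlas_subset_max: "c \<in> A \<Longrightarrow> c \<in> max_atlas A"
  using atlas by (auto simp: smooth_atlas_def max_atlas_def)

lemma atlas_chart: "c \<in> A \<Longrightarrow> is_chart c"
  using atlas by (auto simp: smooth_atlas_def)

lemma chart_at: "chart_at A p \<in> A" "p \<in> fst (chart_at A p)"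
proof -
  have "\<exists>c. c \<in> A \<and> p \<in> fst c"
    using atlas unfolding smooth_atlas_def by blast
  from someI_ex[OF this] show "chart_at A p \<in> A" "p \<in> fst (chart_at A p)"
    by (auto simp: chart_at_def)
qed

lemmas chart_at_is_chart = atlas_chart[OF chart_at(1)]

lemma linear_tangent_of_components:
  "c \<in> max_atlas A \<Longrightarrow> p \<in> fst c \<Longrightarrow> linear (tangent_of_components A c p)"
  unfolding tangent_of_components_def
  using linear_chart_transfer chart_at atlas_chart max_atlasD by metis

lemma components_chart_at: "components A (chart_at A p) p v = v"
  by (simp add: components_def chart_transfer_refl chart_at chart_at_is_chart)

lemma tangent_of_components_components:
  "c \<in> max_atlas A \<Longrightarrow> p \<in> fst c \<Longrightarrow> tangent_of_components A c p (components A c p v) = v"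
  unfolding tangent_of_components_def components_def
  using chart_transfer_inverse chart_at atlas_chart max_atlasD compatible_sym by metis

lemma components_tangent_of_components:
  "c \<in> max_atlas A \<Longrightarrow> p \<in> fst c \<Longrightarrow> components A c p (tangent_of_components A c p v) = v"
  unfolding tangent_of_components_def components_def
  using chart_transfer_inverse chart_at atlas_chart max_atlasD by metis

lemma chart_transfer_components:
  assumes "c \<in> max_atlas A" "d \<in> max_atlas A" "compatible c d" "p \<in> fst c" "p \<in> fst d"
  shows "chart_transfer c d p (components A c p v) = components A d p v"
  unfolding components_def
  using chart_transfer_trans[of "chart_at A p" c d p v] assms chart_at chart_at_is_chart
    max_atlasD compatible_sym by metis

section \<open>Velocities, fields along curves and reparametrization\<close>

lemma velocity_in_chart:
  assumes "smooth_curve A I \<alpha>" "s \<in> I" "c \<in> max_atlas A" "\<alpha> s \<in> fst c"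
  shows "((snd c \<circ> \<alpha>) has_vector_derivative components A c (\<alpha> s) (velocity A \<alpha> s)) (at s)"
proof -
  let ?d = "chart_at A (\<alpha> s)"
  have "open {t \<in> I. \<alpha> t \<in> fst ?d}"
    using open_curve_domain[OF assms(1)] chart_at_is_chart by (simp add: is_chart_def)
  then have "((snd ?d \<circ> \<alpha>) has_vector_derivative velocity A \<alpha> s) (at s)"
    unfolding velocity_def using assms chart_at
    by (intro smooth_on_has_vector_derivative[of "{t \<in> I. \<alpha> t \<in> fst ?d}"])
      (auto simp: smooth_curve_def)
  then show ?thesis
    unfolding components_def
    using vector_derivative_transfer[of ?d c I \<alpha> s "velocity A \<alpha> s"] assms chart_at
      chart_at_is_chart max_atlasD compatible_sym
    by (metis smooth_curve_def)
qed

lemma smooth_field_along_velocity: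
  assumes "smooth_curve A I \<alpha>"
  shows "smooth_field_along A I \<alpha> (velocity A \<alpha>)"
  unfolding smooth_field_along_def
proof
  fix c assume c: "c \<in> A"
  have o: "open {t \<in> I. \<alpha> t \<in> fst c}"
    using open_curve_domain[OF assms] atlas_chart[OF c] by (simp add: is_chart_def)
  have "smooth_on {t \<in> I. \<alpha> t \<in> fst c} (\<lambda>t. vector_derivative (snd c \<circ> \<alpha>) (at t))"
    using assms c o by (intro smooth_on_vector_derivative) (auto simp: smooth_curve_def)
  then show "smooth_on {t \<in> I. \<alpha> t \<in> fst c} (\<lambda>t. components A c (\<alpha> t) (velocity A \<alpha> t))"
    by (rule smooth_on_cong[OF o])
      (use vector_derivative_at[OF velocity_in_chart[OF assms]] atlas_subset_max[OF c] in auto)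
qed

text \<open>The definition provides a smooth extension in some chart around each point. Smoothness
  along curves is tested in every chart of \<open>A\<close>, and covariant derivatives are computed
  in a prescribed one, so the extension has to be carried to any given chart.\<close>

lemma smooth_field_on_in_chart:
  assumes "smooth_field_on A S X" "c \<in> A" "p \<in> S" "p \<in> fst c"
  obtains W F where "open W" "p \<in> W" "W \<subseteq> fst c" "smooth_on (snd c ` W) F"
    "\<And>q. q \<in> W \<inter> S \<Longrightarrow> components A c q (X q) = F (snd c q)"
proof -
  obtain d W F where d: "d \<in> A" "open W" "p \<in> W" "W \<subseteq> fst d" "smooth_on (snd d ` W) F"
    "\<And>q. q \<in> W \<inter> S \<Longrightarrow> components A d q (X q) = F (snd d q)"
    using assms(1,3) unfolding smooth_field_on_def by metis
  have ch: "is_chart c" "is_chart d" "compatible c d" "compatible d c"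
    using atlas assms(2) d(1) by (auto simp: smooth_atlas_def)
  define V where "V = W \<inter> fst c"
  have V: "open V" "p \<in> V" "V \<subseteq> fst c" "V \<subseteq> fst d" "V \<subseteq> W"
    using d assms ch by (auto simp: V_def is_chart_def)
  \<comment> \<open>\<open>G\<close> gives the components in \<open>c\<close> as a function of the
    coordinates in \<open>d\<close>; composing it with the coordinate change makes it a function of
    the coordinates in \<open>c\<close>.\<close>
  define G where "G = (\<lambda>y. chart_transfer d c (chart_inv d y) (F y))"
  have od: "open (snd d ` V)" and oc: "open (snd c ` V)"
    using open_chart_image ch V by blast+
  have "smooth_on (snd d ` V) G"
    unfolding G_def
  proof (rule smooth_on_linear_family[OF od, where L = "\<lambda>y. chart_transfer d c (chart_inv d y)"])
    show "linear (chart_transfer d c (chart_inv d y))" if y: "y \<in> snd d ` V" for y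
    proof -
      obtain q where "q \<in> V" "y = snd d q" using y by blast
      then show ?thesis
        using linear_chart_transfer[OF ch(2,1,4), of q] chart_inv_apply[OF ch(2), of q] V subsetD by metis
    qed
    show "smooth_on (snd d ` V) (\<lambda>y. chart_transfer d c (chart_inv d y) b)" for b
      by (rule smooth_on_subset[OF smooth_on_chart_transfer[OF ch(2,1,4)]]) (use V in auto)
    show "smooth_on (snd d ` V) F"
      by (rule smooth_on_subset[OF d(5)]) (use V in auto)
  qed
  moreover have "smooth_on (snd c ` V) (snd d \<circ> chart_inv c)"
    by (rule smooth_on_subset[of "snd c ` (fst c \<inter> fst d)"])
      (use ch V in \<open>auto simp: compatible_def\<close>)
  ultimately have "smooth_on (snd c ` V) (\<lambda>x. G ((snd d \<circ> chart_inv c) x))"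
    by (rule smooth_on_compose[OF _ _ oc od]) (use V chart_inv_apply[OF ch(1)] in auto)
  moreover have "components A c q (X q) = G ((snd d \<circ> chart_inv c) (snd c q))" if "q \<in> V \<inter> S" for q
  proof -
    have q: "q \<in> fst c" "q \<in> fst d" "q \<in> W \<inter> S" using that V by auto
    then show ?thesis
      using chart_transfer_components[of d c q "X q"] d(1,6) assms(2) atlas_subset_max ch
      by (simp add: G_def chart_inv_apply)
  qed
  ultimately show ?thesis using that V by blast
qed

lemma smooth_field_on_imp_along:
  assumes "smooth_field_on A S X" "smooth_curve A I \<alpha>" "\<alpha> ` I \<subseteq> S"
  shows "smooth_field_along A I \<alpha> (X \<circ> \<alpha>)"
  unfolding smooth_field_along_def
proof (intro ballI smooth_on_local)
  fix c s assume c: "c \<in> A" and s: "s \<in> {t \<in> I. \<alpha> t \<in> fst c}"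
  then have p: "\<alpha> s \<in> S" "\<alpha> s \<in> fst c" using assms(3) by auto
  obtain W F where W: "open W" "\<alpha> s \<in> W" "W \<subseteq> fst c" "smooth_on (snd c ` W) F"
    "\<And>q. q \<in> W \<inter> S \<Longrightarrow> components A c q (X q) = F (snd c q)"
    using smooth_field_on_in_chart[OF assms(1) c p] by blast
  let ?V = "{t \<in> I. \<alpha> t \<in> W}"
  have V: "open ?V" using open_curve_domain[OF assms(2) W(1)] .
  have "smooth_on ?V (snd c \<circ> \<alpha>)"
    by (rule smooth_on_subset[of "{t \<in> I. \<alpha> t \<in> fst c}"])
      (use assms(2) c W(3) in \<open>auto simp: smooth_curve_def\<close>)
  from smooth_on_compose[OF W(4) this V open_chart_image[OF atlas_chart[OF c] W(1,3)]]
  have "smooth_on ?V (\<lambda>t. F ((snd c \<circ> \<alpha>) t))" by auto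
  then have "smooth_on ?V (\<lambda>t. components A c (\<alpha> t) ((X \<circ> \<alpha>) t))"
    by (rule smooth_on_cong[OF V]) (use W(5) assms(3) in auto)
  then show "\<exists>V. open V \<and> s \<in> V \<and> smooth_on V (\<lambda>t. components A c (\<alpha> t) ((X \<circ> \<alpha>) t))"
    using V W(2) s by (intro exI[of _ ?V]) auto
qed

lemma velocity_reparam:
  assumes "smooth_curve A I \<beta>" "\<phi> s \<in> I" "(\<phi> has_real_derivative r) (at s)"
  shows "velocity A (\<beta> \<circ> \<phi>) s = r *\<^sub>R velocity A \<beta> (\<phi> s)"
proof -
  let ?c = "chart_at A (\<beta> (\<phi> s))"
  have "((snd ?c \<circ> \<beta>) has_vector_derivative velocity A \<beta> (\<phi> s)) (at (\<phi> s))"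
    using velocity_in_chart[OF assms(1,2) atlas_subset_max[OF chart_at(1)] chart_at(2)]
    by (simp add: components_chart_at)
  then have "((snd ?c \<circ> \<beta>) \<circ> \<phi> has_vector_derivative r *\<^sub>R velocity A \<beta> (\<phi> s)) (at s)"
    by (intro vector_diff_chain_at)
      (use assms(3) in \<open>simp add: has_real_derivative_iff_has_vector_derivative\<close>)
  from vector_derivative_at[OF this] show ?thesis
    by (simp add: velocity_def o_assoc)
qed

lemma smooth_curve_reparam:
  assumes "smooth_curve A I \<beta>" "open J" "is_interval J" "J \<noteq> {}" "smooth_on J \<phi>" "\<phi> ` J \<subseteq> I"
  shows "smooth_curve A J (\<beta> \<circ> \<phi>)"
proof -
  have cont: "continuous_on J \<phi>" using assms(5) unfolding smooth_on_def by (metis Ck_on.simps(1))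
  have "continuous_on J (\<beta> \<circ> \<phi>)"
    using continuous_on_compose[OF cont, of \<beta>] assms(1,6) continuous_on_subset[of I \<beta> "\<phi> ` J"]
    by (simp add: smooth_curve_def)
  moreover have "smooth_on {t \<in> J. (\<beta> \<circ> \<phi>) t \<in> fst c} (snd c \<circ> (\<beta> \<circ> \<phi>))" if c: "c \<in> A" for c
  proof -
    have o1: "open {t \<in> I. \<beta> t \<in> fst c}"
      using open_curve_domain[OF assms(1)] atlas_chart[OF c] by (simp add: is_chart_def)
    have "{t \<in> J. (\<beta> \<circ> \<phi>) t \<in> fst c} = J \<inter> \<phi> -` {t \<in> I. \<beta> t \<in> fst c}"
      using assms(6) by auto
    then have o2: "open {t \<in> J. (\<beta> \<circ> \<phi>) t \<in> fst c}"
      using continuous_open_preimage[OF cont assms(2) o1] by simp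
    have "smooth_on {t \<in> J. (\<beta> \<circ> \<phi>) t \<in> fst c} (\<lambda>t. (snd c \<circ> \<beta>) (\<phi> t))"
      by (rule smooth_on_compose[OF _ smooth_on_subset[OF assms(5)] o2 o1])
        (use assms(1,6) c in \<open>auto simp: smooth_curve_def comp_def\<close>)
    then show ?thesis by (simp add: comp_def)
  qed
  ultimately show ?thesis using assms(2-4) by (simp add: smooth_curve_def)
qed

end


section \<open>The Levi-Civita connection\<close>

text \<open>Sending \<open>v\<close> to the functional \<open>b v\<close> is injective by
  nondegeneracy, hence surjective by equality of dimensions; \<rho> is a right inverse.\<close>

lemma nondegenerate_form_represents:
  fixes b :: "'v::euclidean_space \<Rightarrow> 'v \<Rightarrow> real"
  assumes "bilinear b" "nondegenerate_on UNIV b"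
  obtains \<rho> :: "('v \<Rightarrow> real) \<Rightarrow> 'v" where "\<And>l w. linear l \<Longrightarrow> b (\<rho> l) w = l w"
proof -
  \<comment> \<open>A functional is encoded by the vector of its values on the basis, so that
    \<open>v\<close> to \<open>b v\<close> becomes an endomorphism of one space.\<close>
  define \<phi> where "\<phi> = (\<lambda>v. \<Sum>i\<in>Basis. b v i *\<^sub>R i)"
  have lin: "linear (\<lambda>v. b v w)" "linear (b v)" for v w
    using assms(1) by (auto simp: bilinear_def)
  have expand: "l w = (\<Sum>i\<in>Basis. (w \<bullet> i) * l i)" if "linear l" for l :: "'v \<Rightarrow> real" and w
    using linear_basis_expansion[OF that, of w] by simp
  have coord: "\<phi> v \<bullet> i = b v i" if "i \<in> Basis" for v i
    using that by (simp add: \<phi>_def)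
  have "linear \<phi>"
    unfolding \<phi>_def
    by (rule linearI) (simp_all add: linear_add[OF lin(1)] linear_scale[OF lin(1)]
        scaleR_left.add sum.distrib scaleR_sum_right)
  moreover have "inj \<phi>"
  proof (rule linear_injective_0[OF \<open>linear \<phi>\<close>, THEN iffD2], intro allI impI)
    fix v assume "\<phi> v = 0"
    then have "b v i = 0" if "i \<in> Basis" for i using coord[OF that, of v] by simp
    then have "b v w = 0" for w using expand[OF lin(2), of v w] by simp
    then show "v = 0" using assms(2) by (simp add: nondegenerate_on_def)
  qed
  ultimately have "surj \<phi>" by (rule linear_injective_imp_surjective) simp
  then have \<phi>_inv: "\<phi> (inv \<phi> x) = x" for x by (rule surj_f_inv_f)
  have "b (inv \<phi> (\<Sum>i\<in>Basis. l i *\<^sub>R i)) w = l w" if "linear l" for l w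
  proof -
    let ?v = "inv \<phi> (\<Sum>i\<in>Basis. l i *\<^sub>R i)"
    have "b ?v i = l i" if "i \<in> Basis" for i
      using coord[OF that, of ?v] \<phi>_inv that by simp
    then show ?thesis using expand[OF lin(2), of ?v w] expand[OF that, of w] by simp
  qed
  then show ?thesis using that[of "\<lambda>l. inv \<phi> (\<Sum>i\<in>Basis. l i *\<^sub>R i)"] by simp
qed

text \<open>The fundamental theorem of semi-Riemannian geometry at a single point:
  \<open>D u v w\<close> plays the role of the derivative along \<open>u\<close> of the product of
  the constant fields \<open>v\<close> and \<open>w\<close>. Constant coordinate fields commute, so
  no bracket terms appear.\<close>

lemma koszul:
  fixes b :: "'v::euclidean_space \<Rightarrow> 'v \<Rightarrow> real" and D :: "'v \<Rightarrow> 'v \<Rightarrow> 'v \<Rightarrow> real"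
  assumes b: "bilinear b" "\<And>u v. b u v = b v u" "nondegenerate_on UNIV b"
    and D: "\<And>v w. linear (\<lambda>u. D u v w)" "\<And>u w. linear (\<lambda>v. D u v w)" "\<And>u v. linear (\<lambda>w. D u v w)"
      "\<And>u v w. D u v w = D u w v"
  shows "\<exists>!\<Gamma>. bilinear \<Gamma> \<and> (\<forall>u v. \<Gamma> u v = \<Gamma> v u) \<and>
    (\<forall>u v w. D u v w = b (\<Gamma> u v) w + b v (\<Gamma> u w))"
proof (rule ex_ex1I)
  have nd: "u = v" if "\<And>w. b u w = b v w" for u v
  proof -
    have "b (u - v) w = 0" for w using that bilinear_lsub[OF b(1)] by simp
    then have "u - v = 0" using b(3) unfolding nondegenerate_on_def by blast
    then show ?thesis by simp
  qed
  have bl: "b (x + y) w = b x w + b y w" "b (r *\<^sub>R x) w = r * b x w" for x y w r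
    using bilinear_ladd[OF b(1)] bilinear_lmul[OF b(1)] by auto
  obtain \<rho> where \<rho>: "\<And>l w. linear l \<Longrightarrow> b (\<rho> l) w = l w"
    using nondegenerate_form_represents[OF b(1,3)] by metis
  \<comment> \<open>The Koszul expression. As a functional of \<open>w\<close> it determines the
    vector \<open>\<Gamma> u v\<close> through the nondegenerate form.\<close>
  define K where "K = (\<lambda>u v w. (D u v w + D v u w - D w u v) / 2)"
  have K: "linear (\<lambda>w. K u v w)" for u v
    by (rule linearI) (simp_all add: K_def linear_add[OF D(3)] linear_scale[OF D(3)]
        linear_add[OF D(1)] linear_scale[OF D(1)] field_simps)
  define \<Gamma> where "\<Gamma> = (\<lambda>u v. \<rho> (K u v))"
  have \<Gamma>: "b (\<Gamma> u v) w = K u v w" for u v w using \<rho>[OF K] by (simp add: \<Gamma>_def)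
  have sym: "\<Gamma> u v = \<Gamma> v u" for u v
    by (rule nd) (use D(4)[of _ u v] in \<open>simp only: \<Gamma> K_def, simp\<close>)
  have "linear (\<Gamma> u)" for u
    by (rule linearI; rule nd) (simp_all add: \<Gamma> bl K_def linear_add[OF D(1)] linear_scale[OF D(1)]
        linear_add[OF D(2)] linear_scale[OF D(2)] linear_add[OF D(3)] linear_scale[OF D(3)] field_simps)
  then have "bilinear \<Gamma>"
    using sym by (simp add: bilinear_def)
  moreover have "D u v w = b (\<Gamma> u v) w + b v (\<Gamma> u w)" for u v w
  proof -
    have "b v (\<Gamma> u w) = K u w v" using b(2) \<Gamma> by metis
    then show ?thesis
      unfolding \<Gamma> K_def using D(4)[of u w v] D(4)[of v w u] D(4)[of w u v] by (simp add: field_simps)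
  qed
  ultimately show "\<exists>\<Gamma>. bilinear \<Gamma> \<and> (\<forall>u v. \<Gamma> u v = \<Gamma> v u) \<and>
    (\<forall>u v w. D u v w = b (\<Gamma> u v) w + b v (\<Gamma> u w))" using sym by blast
  show "\<Gamma>1 = \<Gamma>2" if 1: "bilinear \<Gamma>1 \<and> (\<forall>u v. \<Gamma>1 u v = \<Gamma>1 v u) \<and>
      (\<forall>u v w. D u v w = b (\<Gamma>1 u v) w + b v (\<Gamma>1 u w))"
    and 2: "bilinear \<Gamma>2 \<and> (\<forall>u v. \<Gamma>2 u v = \<Gamma>2 v u) \<and>
      (\<forall>u v w. D u v w = b (\<Gamma>2 u v) w + b v (\<Gamma>2 u w))" for \<Gamma>1 \<Gamma>2
  proof (intro ext nd)
    \<comment> \<open>Adding the compatibility identities for the directions \<open>u\<close> and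
      \<open>v\<close> and subtracting the one for \<open>w\<close> leaves, by symmetry, twice
      \<open>b (\<Gamma> u v) w\<close>. Every candidate is thus forced to satisfy the Koszul
      formula.\<close>
    have *: "b (\<Gamma> u v) w = K u v w" if s: "\<And>u v. \<Gamma> u v = \<Gamma> v u"
      and c: "\<And>u v w. D u v w = b (\<Gamma> u v) w + b v (\<Gamma> u w)" for \<Gamma> u v w
      using c[of u v w] c[of v u w] c[of w u v] s[of u v] s[of u w] s[of v w] b(2)
      by (simp add: K_def)
    fix u v w
    show "b (\<Gamma>1 u v) w = b (\<Gamma>2 u v) w" using *[of \<Gamma>1] *[of \<Gamma>2] 1 2 by metis
  qed
qed

text \<open>A product rule for a moving linear map, where only its derivative on fixed vectors is
  known. Applied once per argument it differentiates a moving bilinear form.\<close>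

lemma has_vector_derivative_linear_family:
  fixes L :: "real \<Rightarrow> 'a::euclidean_space \<Rightarrow> 'b::real_normed_vector"
  assumes "open U" "s \<in> U" "\<And>t. t \<in> U \<Longrightarrow> linear (L t)" "linear L'"
    "\<And>b. ((\<lambda>t. L t b) has_vector_derivative L' b) (at s)"
    "(Y has_vector_derivative Y') (at s)"
  shows "((\<lambda>t. L t (Y t)) has_vector_derivative L s Y' + L' (Y s)) (at s)"
proof -
  have Y: "((\<lambda>t. Y t \<bullet> i) has_real_derivative Y' \<bullet> i) (at s)" for i
    using bounded_linear.has_vector_derivative[OF bounded_linear_inner_left assms(6), of i]
    by (simp add: has_real_derivative_iff_has_vector_derivative)
  have "((\<lambda>t. \<Sum>i\<in>Basis. (Y t \<bullet> i) *\<^sub>R L t i) has_vector_derivative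
      (\<Sum>i\<in>Basis. (Y s \<bullet> i) *\<^sub>R L' i + (Y' \<bullet> i) *\<^sub>R L s i)) (at s)"
    by (intro has_vector_derivative_sum has_vector_derivative_scaleR Y assms(5))
  then have "((\<lambda>t. L t (Y t)) has_vector_derivative
      (\<Sum>i\<in>Basis. (Y s \<bullet> i) *\<^sub>R L' i + (Y' \<bullet> i) *\<^sub>R L s i)) (at s)"
    by (rule has_vector_derivative_transform_within_open[OF _ assms(1,2)])
      (use linear_basis_expansion[OF assms(3)] in simp)
  moreover have "(\<Sum>i\<in>Basis. (Y s \<bullet> i) *\<^sub>R L' i + (Y' \<bullet> i) *\<^sub>R L s i) = L s Y' + L' (Y s)"
    using linear_basis_expansion[OF assms(3)[OF assms(2)], of Y'] linear_basis_expansion[OF assms(4), of "Y s"]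
    by (simp add: sum.distrib)
  ultimately show ?thesis by simp
qed

context
  fixes A :: "('a::{t2_space,second_countable_topology}, 'n::finite) chart set"
    and g :: "'a \<Rightarrow> real ^ 'n \<Rightarrow> real ^ 'n \<Rightarrow> real" and \<nu> :: nat
  assumes mfd: "semi_riemannian_manifold A g \<nu>"
begin

section \<open>The metric in charts and its connection\<close>

lemma mfd_atlas: "smooth_atlas A"
  and metric_bilinear: "bilinear (g p)"
  and metric_sym: "g p u v = g p v u"
  and metric_nondegenerate: "nondegenerate_on UNIV (g p)"
  and smooth_metric_in_chart:
    "c \<in> A \<Longrightarrow> smooth_on (snd c ` fst c) (\<lambda>x. metric_in_chart A g c x u v)"
  using mfd by (auto simp: semi_riemannian_manifold_def)

lemma metric_linear: "linear (g p u)" "linear (\<lambda>u. g p u v)"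
  using metric_bilinear by (auto simp: bilinear_def)

lemma metric_in_chart_components:
  assumes "c \<in> A" "p \<in> fst c"
  shows "metric_in_chart A g c (snd c p) (components A c p u) (components A c p v) = g p u v"
  using assms atlas_chart[OF mfd_atlas] atlas_subset_max[OF mfd_atlas]
  by (simp add: metric_in_chart_def chart_inv_apply tangent_of_components_components[OF mfd_atlas])

lemma metric_in_chart_chart_at:
  "metric_in_chart A g (chart_at A p) (snd (chart_at A p) p) u v = g p u v"
  using metric_in_chart_components[OF chart_at[OF mfd_atlas], of p u v]
  by (simp add: components_chart_at[OF mfd_atlas])

lemma linear_metric_in_chart:
  assumes "c \<in> A" "x \<in> snd c ` fst c"
  shows "linear (metric_in_chart A g c x u)" "linear (\<lambda>u. metric_in_chart A g c x u v)"
    and metric_in_chart_sym: "metric_in_chart A g c x u v = metric_in_chart A g c x v u"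
proof -
  have l: "linear (tangent_of_components A c (chart_inv c x))"
    using assms linear_tangent_of_components[OF mfd_atlas] atlas_subset_max[OF mfd_atlas]
      chart_inv_in atlas_chart[OF mfd_atlas] by metis
  show "linear (metric_in_chart A g c x u)" "linear (\<lambda>u. metric_in_chart A g c x u v)"
    unfolding metric_in_chart_def Let_def
    using linear_compose[OF l metric_linear(1)] linear_compose[OF l metric_linear(2)]
    by (simp_all add: comp_def)
  show "metric_in_chart A g c x u v = metric_in_chart A g c x v u"
    by (simp add: metric_in_chart_def Let_def metric_sym)
qed

lemma metric_in_chart_has_derivative:
  assumes "c \<in> A" "x \<in> snd c ` fst c"
  shows "((\<lambda>x. metric_in_chart A g c x v w) has_derivative
    frechet_derivative (\<lambda>x. metric_in_chart A g c x v w) (at x)) (at x)"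
  by (rule smooth_on_imp_has_derivative[OF smooth_metric_in_chart[OF assms(1)] _ assms(2)])
    (use assms atlas_chart[OF mfd_atlas] in \<open>simp add: is_chart_def\<close>)

text \<open>Uniqueness of derivatives carries linearity and symmetry from the metric at nearby
  points to its derivative. These are exactly the inputs of \<open>koszul\<close>.\<close>

lemma frechet_derivative_metric_in_chart:
  assumes c: "c \<in> A" "x \<in> snd c ` fst c"
  defines "D \<equiv> \<lambda>u v w. frechet_derivative (\<lambda>x. metric_in_chart A g c x v w) (at x) u"
  shows "linear (\<lambda>u. D u v w)" "linear (\<lambda>v. D u v w)" "linear (\<lambda>w. D u v w)" "D u v w = D u w v"
proof -
  have op: "open (snd c ` fst c)"
    using c(1) atlas_chart[OF mfd_atlas] by (simp add: is_chart_def)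
  have d: "((\<lambda>x. metric_in_chart A g c x v w) has_derivative (\<lambda>u. D u v w)) (at x)" for v w
    using metric_in_chart_has_derivative[OF c] by (simp add: D_def)
  have eq: "D u v w = f' u" if "(f has_derivative f') (at x)"
    "\<And>y. y \<in> snd c ` fst c \<Longrightarrow> f y = metric_in_chart A g c y v w" for f f' u v w
    using has_derivative_unique[OF d has_derivative_transform_within_open[OF that(1) op c(2) that(2)]]
    by metis
  show "linear (\<lambda>u. D u v w)" using d has_derivative_linear by blast
  show sym: "D u v w = D u w v" for u v w
    by (rule eq[OF d]) (rule metric_in_chart_sym[OF c(1)])
  show lin: "linear (\<lambda>w. D u v w)" for u v
  proof (rule linearI)
    show "D u v (w + w') = D u v w + D u v w'" for w w'
      by (rule eq[OF has_derivative_add[OF d d]])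
        (simp add: linear_add[OF linear_metric_in_chart(1)[OF c(1)]])
    show "D u v (r *\<^sub>R w) = r *\<^sub>R D u v w" for r w
      by (rule eq[OF has_derivative_scaleR_right[OF d]])
        (simp add: linear_scale[OF linear_metric_in_chart(1)[OF c(1)]])
  qed
  show "linear (\<lambda>v. D u v w)" using lin[of u w] sym by simp
qed

text \<open>Unique existence justifies the definite description. In the chart
  \<open>chart_at A p\<close> tangent vectors at \<open>p\<close> are their own components and the
  metric of the chart at the image of \<open>p\<close> is \<open>g p\<close>, so both properties can
  be stated with \<open>g p\<close>.\<close>

lemma levi_civita:
  defines "\<Gamma> \<equiv> \<lambda>p. levi_civita A g (chart_at A p) p"
  shows levi_civita_bilinear: "bilinear (\<Gamma> p)"
    and levi_civita_metric:
      "frechet_derivative (\<lambda>x. metric_in_chart A g (chart_at A p) x v w) (at (snd (chart_at A p) p)) u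
        = g p (\<Gamma> p u v) w + g p v (\<Gamma> p u w)"
proof -
  let ?c = "chart_at A p"
  let ?D = "\<lambda>u v w. frechet_derivative (\<lambda>x. metric_in_chart A g ?c x v w) (at (snd ?c p)) u"
  have c: "?c \<in> A" "snd ?c p \<in> snd ?c ` fst ?c" using chart_at[OF mfd_atlas] by auto
  have "\<exists>!\<Gamma>. bilinear \<Gamma> \<and> (\<forall>u v. \<Gamma> u v = \<Gamma> v u) \<and>
      (\<forall>u v w. ?D u v w = g p (\<Gamma> u v) w + g p v (\<Gamma> u w))"
    by (rule koszul) (fact metric_bilinear metric_sym metric_nondegenerate
        frechet_derivative_metric_in_chart[OF c])+
  from theI'[OF this]
  have "bilinear (\<Gamma> p) \<and> (\<forall>u v. \<Gamma> p u v = \<Gamma> p v u) \<and>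
      (\<forall>u v w. ?D u v w = g p (\<Gamma> p u v) w + g p v (\<Gamma> p u w))"
    unfolding \<Gamma>_def levi_civita_def metric_in_chart_chart_at .
  then show "bilinear (\<Gamma> p)" "?D u v w = g p (\<Gamma> p u v) w + g p v (\<Gamma> p u w)" by blast+
qed

section \<open>Products of fields along a curve and their derivatives\<close>

lemma metric_along_in_chart:
  assumes "c \<in> A" "\<alpha> t \<in> fst c"
  shows "g (\<alpha> t) u v = metric_in_chart A g c ((snd c \<circ> \<alpha>) t) (components A c (\<alpha> t) u)
    (components A c (\<alpha> t) v)"
  using metric_in_chart_components[OF assms] by simp

text \<open>The product is handled as two nested families of linear maps, \<open>Y\<close> being
  inserted first for constant left arguments and \<open>X\<close> afterwards.\<close>

lemma smooth_on_metric_along: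
  assumes "smooth_curve A I \<alpha>" "smooth_field_along A I \<alpha> X" "smooth_field_along A I \<alpha> Y"
  shows "smooth_on I (\<lambda>t. g (\<alpha> t) (X t) (Y t))"
proof (rule smooth_on_local)
  fix s assume s: "s \<in> I"
  define c where "c = chart_at A (\<alpha> s)"
  have c: "c \<in> A" "\<alpha> s \<in> fst c" using chart_at[OF mfd_atlas] by (auto simp: c_def)
  let ?V = "{t \<in> I. \<alpha> t \<in> fst c}"
  have ch: "is_chart c" using atlas_chart[OF mfd_atlas c(1)] .
  have V: "open ?V" using open_curve_domain[OF assms(1)] ch by (simp add: is_chart_def)
  have G: "smooth_on ?V (\<lambda>t. metric_in_chart A g c ((snd c \<circ> \<alpha>) t) u v)" for u v
    by (rule smooth_on_compose[OF smooth_metric_in_chart[OF c(1)] _ V])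
      (use assms(1) c ch in \<open>auto simp: smooth_curve_def is_chart_def comp_def\<close>)
  have x: "(snd c \<circ> \<alpha>) t \<in> snd c ` fst c" if "t \<in> ?V" for t using that by auto
  note lin = linear_metric_in_chart[OF c(1) x]
  have "smooth_on ?V (\<lambda>t. metric_in_chart A g c ((snd c \<circ> \<alpha>) t) u (components A c (\<alpha> t) (Y t)))" for u
    by (rule smooth_on_linear_family[OF V lin(1) G]) (use assms(3) c in \<open>auto simp: smooth_field_along_def\<close>)
  then have "smooth_on ?V (\<lambda>t. metric_in_chart A g c ((snd c \<circ> \<alpha>) t)
      (components A c (\<alpha> t) (X t)) (components A c (\<alpha> t) (Y t)))"
    by (rule smooth_on_linear_family[OF V, rotated, where L = "\<lambda>t u. metric_in_chart A g c
        ((snd c \<circ> \<alpha>) t) u (components A c (\<alpha> t) (Y t))" and h = "\<lambda>t. components A c (\<alpha> t) (X t)"])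
      (use assms(2) c lin(2) in \<open>auto simp: smooth_field_along_def\<close>)
  then have "smooth_on ?V (\<lambda>t. g (\<alpha> t) (X t) (Y t))"
    by (rule smooth_on_cong[OF V]) (use metric_along_in_chart[OF c(1), of \<alpha>, symmetric] in auto)
  then show "\<exists>V. open V \<and> s \<in> V \<and> smooth_on V (\<lambda>t. g (\<alpha> t) (X t) (Y t))"
    using V s c(2) by (intro exI[of _ ?V]) auto
qed

lemma smooth_field_along_components:
  assumes "smooth_curve A I \<alpha>" "smooth_field_along A I \<alpha> X" "s \<in> I"
  defines "c \<equiv> chart_at A (\<alpha> s)"
  shows "((\<lambda>t. components A c (\<alpha> t) (X t)) has_vector_derivative
    vector_derivative (\<lambda>t. components A c (\<alpha> t) (X t)) (at s)) (at s)"
proof -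
  have c: "c \<in> A" "\<alpha> s \<in> fst c" using chart_at[OF mfd_atlas] by (auto simp: c_def)
  have "open {t \<in> I. \<alpha> t \<in> fst c}"
    using open_curve_domain[OF assms(1)] atlas_chart[OF mfd_atlas c(1)] by (simp add: is_chart_def)
  then show ?thesis
    by (rule smooth_on_has_vector_derivative[rotated])
      (use assms(2,3) c in \<open>auto simp: smooth_field_along_def\<close>)
qed

text \<open>In a chart the derivative has one term for each field and one for the moving base point.
  Compatibility of the connection splits the last term into the two connection terms that complete
  the covariant derivatives.\<close>

lemma metric_along_has_derivative:
  assumes "smooth_curve A I \<alpha>" "smooth_field_along A I \<alpha> X" "smooth_field_along A I \<alpha> Y" "s \<in> I"
  shows "((\<lambda>t. g (\<alpha> t) (X t) (Y t)) has_real_derivative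
    g (\<alpha> s) (cov_deriv_along A g \<alpha> X s) (Y s) + g (\<alpha> s) (X s) (cov_deriv_along A g \<alpha> Y s)) (at s)"
proof -
  define c where "c = chart_at A (\<alpha> s)"
  have c: "c \<in> A" "\<alpha> s \<in> fst c" "\<And>v. components A c (\<alpha> s) v = v"
    using chart_at[OF mfd_atlas] components_chart_at[OF mfd_atlas] by (auto simp: c_def)
  let ?V = "{t \<in> I. \<alpha> t \<in> fst c}"
  have ch: "is_chart c" using atlas_chart[OF mfd_atlas c(1)] .
  have V: "open ?V" "s \<in> ?V"
    using open_curve_domain[OF assms(1)] ch assms(4) c(2) by (auto simp: is_chart_def)
  define x where "x = snd c \<circ> \<alpha>"
  define Xc where "Xc = (\<lambda>t. components A c (\<alpha> t) (X t))"
  define Yc where "Yc = (\<lambda>t. components A c (\<alpha> t) (Y t))"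
  define X' where "X' = vector_derivative Xc (at s)"
  define Y' where "Y' = vector_derivative Yc (at s)"
  define G where "G = metric_in_chart A g c"
  define D where "D = (\<lambda>u v. frechet_derivative (\<lambda>x. G x u v) (at (x s)) (velocity A \<alpha> s))"
  define \<Gamma> where "\<Gamma> = levi_civita A g c (\<alpha> s) (velocity A \<alpha> s)"
  have X: "(Xc has_vector_derivative X') (at s)" and Y: "(Yc has_vector_derivative Y') (at s)"
    using smooth_field_along_components[OF assms(1) _ assms(4)] assms(2,3)
    by (auto simp: Xc_def Yc_def X'_def Y'_def c_def)
  have at_s: "Xc s = X s" "Yc s = Y s" using c(3) by (auto simp: Xc_def Yc_def)
  have xin: "x t \<in> snd c ` fst c" if "t \<in> ?V" for t using that by (auto simp: x_def)
  have Gs: "G (x s) u v = g (\<alpha> s) u v" for u v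
    using metric_in_chart_chart_at by (simp add: G_def x_def c_def)
  have x': "(x has_vector_derivative velocity A \<alpha> s) (at s)"
    using velocity_in_chart[OF mfd_atlas assms(1,4) atlas_subset_max[OF mfd_atlas c(1)] c(2)]
    by (simp add: x_def c(3))
  have GD: "((\<lambda>t. G (x t) u v) has_vector_derivative D u v) (at s)" for u v
  proof -
    have "((\<lambda>x. G x u v) has_derivative frechet_derivative (\<lambda>x. G x u v) (at (x s))) (at (x s))"
      using metric_in_chart_has_derivative[OF c(1) xin[OF V(2)]] by (simp add: G_def)
    from vector_derivative_diff_chain_within[OF x' has_derivative_at_withinI[OF this]]
    show ?thesis by (simp add: D_def comp_def)
  qed
  have linG: "linear (G (x t) u)" "linear (\<lambda>u. G (x t) u v)" if "t \<in> ?V" for t u v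
    unfolding G_def by (fact linear_metric_in_chart[OF c(1) xin[OF that]])+
  have linD: "linear (D u)" "linear (\<lambda>u. D u v)" for u v
    unfolding D_def G_def by (fact frechet_derivative_metric_in_chart[OF c(1) xin[OF V(2)]])+
  \<comment> \<open>The arguments are differentiated one at a time: here \<open>Y\<close> with the
    left argument frozen, and then \<open>X\<close> in the linear family that already contains the
    moving \<open>Y\<close>.\<close>
  have 1: "((\<lambda>t. G (x t) u (Yc t)) has_vector_derivative G (x s) u Y' + D u (Yc s)) (at s)" for u
    by (rule has_vector_derivative_linear_family[OF V linG(1) linD(1) GD Y])
  have lin1: "linear (\<lambda>u. G (x s) u Y' + D u (Yc s))"
    by (intro linear_compose_add linG(2)[OF V(2)] linD)
  have "((\<lambda>t. G (x t) (Xc t) (Yc t)) has_vector_derivative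
      G (x s) X' (Yc s) + (G (x s) (Xc s) Y' + D (Xc s) (Yc s))) (at s)"
    by (rule has_vector_derivative_linear_family[OF V linG(2) lin1 1 X])
  then have "((\<lambda>t. g (\<alpha> t) (X t) (Y t)) has_vector_derivative
      G (x s) X' (Yc s) + (G (x s) (Xc s) Y' + D (Xc s) (Yc s))) (at s)"
    by (rule has_vector_derivative_transform_within_open[OF _ V])
      (use metric_along_in_chart[OF c(1), of \<alpha>, symmetric] in \<open>auto simp: G_def x_def Xc_def Yc_def\<close>)
  moreover have "D (Xc s) (Yc s) = g (\<alpha> s) (\<Gamma> (X s)) (Y s) + g (\<alpha> s) (X s) (\<Gamma> (Y s))"
    using levi_civita_metric[of "\<alpha> s"] by (simp add: D_def G_def \<Gamma>_def at_s x_def c_def)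
  moreover have "cov_deriv_along A g \<alpha> X s = X' + \<Gamma> (X s)" "cov_deriv_along A g \<alpha> Y s = Y' + \<Gamma> (Y s)"
    by (auto simp: cov_deriv_along_def Let_def X'_def Xc_def Y'_def Yc_def \<Gamma>_def c_def)
  ultimately show ?thesis
    by (simp add: has_real_derivative_iff_has_vector_derivative Gs at_s algebra_simps
        linear_add[OF metric_linear(1)] linear_add[OF metric_linear(2)])
qed

text \<open>Near \<open>p\<close> the components agree, on the coordinate image of \<open>S\<close>,
  with a smooth map on an open set. So a derivative within that image exists, and the one selected
  by \<open>frechet_derivative\<close> is a genuine derivative, although possibly not that of the
  extension.\<close>

lemma field_has_derivative_within:
  assumes "smooth_field_on A S X" "p \<in> S"
  defines "c \<equiv> chart_at A p"
  defines "f \<equiv> \<lambda>x. components A c (chart_inv c x) (X (chart_inv c x))"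
  shows "(f has_derivative frechet_derivative f (at (snd c p) within snd c ` (S \<inter> fst c)))
    (at (snd c p) within snd c ` (S \<inter> fst c))"
proof -
  have c: "c \<in> A" "p \<in> fst c" using chart_at[OF mfd_atlas] by (auto simp: c_def)
  note ch = atlas_chart[OF mfd_atlas c(1)]
  obtain W F where W: "open W" "p \<in> W" "W \<subseteq> fst c" "smooth_on (snd c ` W) F"
    "\<And>q. q \<in> W \<inter> S \<Longrightarrow> components A c q (X q) = F (snd c q)"
    using smooth_field_on_in_chart[OF mfd_atlas assms(1) c(1) assms(2) c(2)] by blast
  let ?T = "snd c ` (S \<inter> fst c)"
  have oW: "open (snd c ` W)" using open_chart_image[OF ch W(1,3)] .
  obtain F' where "(F has_derivative F') (at (snd c p))"
    using smooth_on_imp_has_derivative[OF W(4) oW] W(2) by blast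
  then have "(f has_derivative F') (at (snd c p) within ?T \<inter> snd c ` W)"
  proof (rule has_derivative_transform[rotated 2, OF has_derivative_at_withinI])
    show "snd c p \<in> ?T \<inter> snd c ` W" using assms(2) c(2) W(2) by auto
    fix x assume "x \<in> ?T \<inter> snd c ` W"
    then obtain q r where qr: "x = snd c q" "q \<in> S" "q \<in> fst c" "x = snd c r" "r \<in> W" by blast
    then have "q = r" using chart_inv_apply[OF ch] W(3) by (metis subsetD)
    then show "f x = F x" using W(5)[of q] qr chart_inv_apply[OF ch] by (simp add: f_def)
  qed
  moreover have "at (snd c p) within ?T \<inter> snd c ` W = at (snd c p) within ?T"
    by (rule at_within_nhd[of _ "snd c ` W"]) (use W(2) oW in auto)
  ultimately show ?thesis using frechet_derivative_works differentiableI by metis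
qed

text \<open>Whichever derivative is selected, it is linear on the whole coordinate space. Linearity
  therefore holds without restriction to the tangent space, even where the values have no geometric
  meaning.\<close>

lemma linear_shape_operator:
  assumes "smooth_field_on A S X" "p \<in> S"
  shows "linear (shape_operator A g S X p)"
proof -
  have "linear (\<lambda>v. levi_civita A g (chart_at A p) p v (X p))"
    using levi_civita_bilinear[of p] by (simp add: bilinear_def)
  then show ?thesis
    unfolding shape_operator_def cov_deriv_on_def Let_def
    by (intro linear_compose_neg linear_compose_add
        has_derivative_linear[OF field_has_derivative_within[OF assms]])
qed

text \<open>The derivative within a set in \<open>cov_deriv_on\<close> need not be unique, but by the chain rule all
  its choices agree on the velocities of curves that stay in the set.\<close>

lemma cov_deriv_along_restrict:
  assumes "smooth_field_on A S X" "smooth_curve A I \<alpha>" "\<alpha> ` I \<subseteq> S" "s \<in> I"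
  shows "cov_deriv_along A g \<alpha> (X \<circ> \<alpha>) s = - shape_operator A g S X (\<alpha> s) (velocity A \<alpha> s)"
proof -
  define c where "c = chart_at A (\<alpha> s)"
  define f where "f = (\<lambda>x. components A c (chart_inv c x) (X (chart_inv c x)))"
  have c: "c \<in> A" "\<alpha> s \<in> fst c" "\<And>v. components A c (\<alpha> s) v = v"
    using chart_at[OF mfd_atlas] components_chart_at[OF mfd_atlas] by (auto simp: c_def)
  note ch = atlas_chart[OF mfd_atlas c(1)]
  let ?T = "snd c ` (S \<inter> fst c)"
  let ?V = "{t \<in> I. \<alpha> t \<in> fst c}"
  define f' where "f' = frechet_derivative f (at (snd c (\<alpha> s)) within ?T)"
  have V: "open ?V" "s \<in> ?V"
    using open_curve_domain[OF assms(2)] ch assms(4) c(2) by (auto simp: is_chart_def)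
  have "\<alpha> s \<in> S" using assms(3,4) by auto
  from field_has_derivative_within[OF assms(1) this]
  have f': "(f has_derivative f') (at (snd c (\<alpha> s)) within ?T)"
    by (simp add: f_def c_def f'_def)
  have "((snd c \<circ> \<alpha>) has_vector_derivative velocity A \<alpha> s) (at s within ?V)"
    using velocity_in_chart[OF mfd_atlas assms(2,4) atlas_subset_max[OF mfd_atlas c(1)] c(2)]
    by (simp add: c(3) has_vector_derivative_at_within)
  then have "(f \<circ> (snd c \<circ> \<alpha>) has_vector_derivative f' (velocity A \<alpha> s)) (at s within ?V)"
    by (rule vector_derivative_diff_chain_within)
      (use has_derivative_subset[OF f', of "(snd c \<circ> \<alpha>) ` ?V"] assms(3) in \<open>auto simp: image_subset_iff\<close>)
  then have "(f \<circ> (snd c \<circ> \<alpha>) has_vector_derivative f' (velocity A \<alpha> s)) (at s)"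
    using at_within_open[OF V(2,1)] by simp
  then have "((\<lambda>t. components A c (\<alpha> t) ((X \<circ> \<alpha>) t)) has_vector_derivative f' (velocity A \<alpha> s)) (at s)"
    by (rule has_vector_derivative_transform_within_open[OF _ V])
      (use chart_inv_apply[OF ch] in \<open>auto simp: f_def\<close>)
  from vector_derivative_at[OF this] show ?thesis
    by (simp add: cov_deriv_along_def shape_operator_def cov_deriv_on_def Let_def f'_def f_def c_def)
qed

end


section \<open>Tangent spaces of hypersurfaces\<close>

text \<open>\<open>tangent_space\<close> admits only curves that pass through the point at parameter
  0, so the parameter is shifted by \<open>s\<close>.\<close>

lemma velocity_in_tangent_space:
  assumes "smooth_atlas A" "smooth_curve A I \<alpha>" "\<alpha> ` I \<subseteq> S" "s \<in> I"
  shows "velocity A \<alpha> s \<in> tangent_space A S (\<alpha> s)"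
proof -
  define J where "J = (\<lambda>t. t + s) -` I"
  have I: "open I" "is_interval I" using assms(2) by (auto simp: smooth_curve_def)
  have J: "open J" "is_interval J" "0 \<in> J"
  proof -
    show "open J" unfolding J_def by (rule open_vimage[OF I(1)]) (intro continuous_intros)
    show "is_interval J"
      unfolding is_interval_1
    proof (intro ballI allI impI)
      fix a b x assume "a \<in> J" "b \<in> J" "a \<le> x \<and> x \<le> b"
      then show "x \<in> J"
        using mem_is_interval_1_I[OF I(2), of "a + s" "b + s" "x + s"] by (simp add: J_def)
    qed
    show "0 \<in> J" using assms(4) by (simp add: J_def)
  qed
  have "smooth_on J (\<lambda>t. t + s)"
    by (intro smooth_on_add smooth_on_id smooth_on_const J)
  then have "smooth_curve A J (\<alpha> \<circ> (\<lambda>t. t + s))"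
    using J by (intro smooth_curve_reparam[OF assms(1,2)]) (auto simp only: J_def vimage_def)
  moreover have "velocity A (\<alpha> \<circ> (\<lambda>t. t + s)) 0 = 1 *\<^sub>R velocity A \<alpha> (0 + s)"
    by (rule velocity_reparam[OF assms(1,2)]) (auto intro!: derivative_eq_intros simp: assms(4))
  ultimately show ?thesis
    unfolding tangent_space_def using J(3) assms(3)
    by (intro CollectI exI[of _ "\<alpha> \<circ> (\<lambda>t. t + s)"] exI[of _ J]) (auto simp: J_def)
qed

text \<open>A slice chart straightens the hypersurface, which turns a set of velocities into a
  coordinate hyperplane. One inclusion differentiates the coordinate that vanishes along the curve;
  the other pulls back a straight line in the slice.\<close>

lemma tangent_space_slice:
  assumes "smooth_atlas A" "c \<in> max_atlas A" "p \<in> S" "p \<in> fst c"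
    "snd c ` (S \<inter> fst c) = {x \<in> snd c ` fst c. x $ k = 0}"
  shows "tangent_space A S p = tangent_of_components A c p ` {w. w $ k = 0}"
proof (intro equalityI subsetI)
  note ch = max_atlasD(1)[OF assms(2)]
  fix v assume "v \<in> tangent_space A S p"
  then obtain \<beta> I where \<beta>: "v = velocity A \<beta> 0" "smooth_curve A I \<beta>" "0 \<in> I" "\<beta> ` I \<subseteq> S" "\<beta> 0 = p"
    unfolding tangent_space_def by blast
  let ?V = "{t \<in> I. \<beta> t \<in> fst c}"
  have V: "open ?V" "0 \<in> ?V"
    using open_curve_domain[OF \<beta>(2)] ch \<beta>(3,5) assms(4) by (auto simp: is_chart_def)
  have zero: "(snd c \<circ> \<beta>) t $ k = 0" if "t \<in> ?V" for t
  proof -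
    have "snd c (\<beta> t) \<in> snd c ` (S \<inter> fst c)" using that \<beta>(4) by auto
    then show ?thesis unfolding assms(5) by simp
  qed
  have "((\<lambda>t. (snd c \<circ> \<beta>) t $ k) has_vector_derivative components A c p v $ k) (at 0)"
    using bounded_linear.has_vector_derivative[OF bounded_linear_vec_nth
        velocity_in_chart[OF assms(1) \<beta>(2,3) assms(2)], of k] \<beta>(1,5) assms(4) by simp
  then have "((\<lambda>t. 0 :: real) has_vector_derivative components A c p v $ k) (at 0)"
    by (rule has_vector_derivative_transform_within_open[OF _ V zero])
  then have "components A c p v $ k = 0"
    using vector_derivative_unique_at[OF _ has_vector_derivative_const] by blast
  then show "v \<in> tangent_of_components A c p ` {w. w $ k = 0}"
    using tangent_of_components_components[OF assms(1,2,4), of v] by (intro image_eqI[of _ _ "components A c p v"]) auto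
next
  note ch = max_atlasD(1)[OF assms(2)]
  fix v assume "v \<in> tangent_of_components A c p ` {w. w $ k = 0}"
  then obtain w where w: "v = tangent_of_components A c p w" "w $ k = 0" by auto
  define \<gamma> where "\<gamma> = (\<lambda>t::real. snd c p + t *\<^sub>R w)"
  have \<gamma>_smooth: "smooth_on I \<gamma>" if "open I" for I
    unfolding \<gamma>_def by (intro smooth_on_add smooth_on_scaleR smooth_on_id smooth_on_const that)
  have \<gamma>_cont: "continuous_on I \<gamma>" for I unfolding \<gamma>_def by (intro continuous_intros)
  have "open (snd c ` fst c)" using ch by (simp add: is_chart_def)
  then have "open (\<gamma> -` (snd c ` fst c))" by (rule open_vimage[OF _ \<gamma>_cont])
  moreover have "0 \<in> \<gamma> -` (snd c ` fst c)" using assms(4) by (simp add: \<gamma>_def)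
  \<comment> \<open>The preimage of the chart image under the line need not be an interval, as the
    domain of a curve must be; a ball around 0 is one.\<close>
  ultimately obtain d where d: "d > 0" "ball 0 d \<subseteq> \<gamma> -` (snd c ` fst c)"
    using open_contains_ball by metis
  define I where "I = ball (0::real) d"
  have I: "open I" "is_interval I" "0 \<in> I" "\<And>t. t \<in> I \<Longrightarrow> \<gamma> t \<in> snd c ` fst c"
    using d by (auto simp: I_def is_interval_ball_real)
  define \<beta> where "\<beta> = chart_inv c \<circ> \<gamma>"
  have c\<beta>: "snd c (\<beta> t) = \<gamma> t" "\<beta> t \<in> fst c" if "t \<in> I" for t
    using chart_apply_inv[OF ch I(4)[OF that]] chart_inv_in[OF ch I(4)[OF that]] by (auto simp: \<beta>_def)
  have \<beta>0: "\<beta> 0 = p" using chart_inv_apply[OF ch assms(4)] by (simp add: \<beta>_def \<gamma>_def)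
  have pk: "snd c p $ k = 0"
  proof -
    have "snd c p \<in> snd c ` (S \<inter> fst c)" using assms(3,4) by auto
    then show ?thesis unfolding assms(5) by simp
  qed
  have \<beta>S: "\<beta> t \<in> S" if t: "t \<in> I" for t
  proof -
    have "\<gamma> t \<in> snd c ` (S \<inter> fst c)"
      unfolding assms(5) using I(4)[OF t] pk w(2) by (simp add: \<gamma>_def)
    then obtain q where "q \<in> S" "q \<in> fst c" "\<gamma> t = snd c q" by blast
    then show ?thesis using chart_inv_apply[OF ch] by (simp add: \<beta>_def)
  qed
  have "continuous_on I \<beta>"
  proof -
    have "continuous_on (snd c ` fst c) (chart_inv c)"
      using ch by (simp add: is_chart_def homeomorphism_def)
    then show ?thesis unfolding \<beta>_def
      using I(4) by (intro continuous_on_compose \<gamma>_cont) (auto intro: continuous_on_subset)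
  qed
  moreover have "smooth_on {t \<in> I. \<beta> t \<in> fst d} (snd d \<circ> \<beta>)" if "d \<in> A" for d
  proof -
    have dch: "is_chart d" "compatible c d"
      using atlas_chart[OF assms(1) that] max_atlasD(2)[OF assms(2) that] by auto
    have "{t \<in> I. \<beta> t \<in> fst d} = I \<inter> \<beta> -` fst d" by auto
    then have o: "open {t \<in> I. \<beta> t \<in> fst d}"
      using continuous_open_preimage[OF \<open>continuous_on I \<beta>\<close> I(1), of "fst d"] dch
      by (simp add: is_chart_def)
    have "smooth_on {t \<in> I. \<beta> t \<in> fst d} (\<lambda>t. (snd d \<circ> chart_inv c) (\<gamma> t))"
    proof (rule smooth_on_compose[OF _ \<gamma>_smooth[OF o] o open_overlap[OF ch dch(1)]])
      show "smooth_on (snd c ` (fst c \<inter> fst d)) (snd d \<circ> chart_inv c)"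
        using dch(2) by (simp add: compatible_def)
      show "\<gamma> t \<in> snd c ` (fst c \<inter> fst d)" if "t \<in> {t \<in> I. \<beta> t \<in> fst d}" for t
        using that c\<beta>[of t] by (intro image_eqI[of _ _ "\<beta> t"]) auto
    qed
    then show ?thesis by (simp add: \<beta>_def comp_def)
  qed
  ultimately have curve: "smooth_curve A I \<beta>" using I by (auto simp: smooth_curve_def)
  have "(\<gamma> has_vector_derivative w) (at 0)"
    unfolding \<gamma>_def by (auto intro!: derivative_eq_intros simp: has_vector_derivative_def)
  then have "((snd c \<circ> \<beta>) has_vector_derivative w) (at 0)"
    by (rule has_vector_derivative_transform_within_open[OF _ I(1,3)]) (use c\<beta> in auto)
  moreover have "((snd c \<circ> \<beta>) has_vector_derivative components A c p (velocity A \<beta> 0)) (at 0)"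
    using velocity_in_chart[OF assms(1) curve I(3) assms(2)] \<beta>0 assms(4) by simp
  ultimately have "components A c p (velocity A \<beta> 0) = w"
    using vector_derivative_unique_at by metis
  then have "velocity A \<beta> 0 = v"
    using tangent_of_components_components[OF assms(1,2,4), of "velocity A \<beta> 0"] w(1) by simp
  then show "v \<in> tangent_space A S p"
    unfolding tangent_space_def using curve I(3) \<beta>S \<beta>0 by blast
qed

text \<open>Passing from components in a slice chart to tangent vectors is a linear isomorphism, so
  the tangent space inherits both properties from the coordinate hyperplane.\<close>

lemma tangent_space:
  fixes A :: "('a::topological_space, 'n::finite) chart set"
  assumes "smooth_atlas A" "hypersurface A S" "p \<in> S"
  shows subspace_tangent_space: "subspace (tangent_space A S p)"
    and dim_tangent_space: "dim (tangent_space A S p) = CARD('n) - 1"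
proof -
  obtain c k where c: "c \<in> max_atlas A" "p \<in> fst c"
    "snd c ` (S \<inter> fst c) = {x \<in> snd c ` fst c. x $ k = 0}"
    using assms(2,3) unfolding hypersurface_def by blast
  let ?H = "{w :: real ^ 'n. w $ k = 0}"
  have H: "?H = {w. axis k 1 \<bullet> w = 0}" by (simp add: inner_axis')
  have sub: "subspace ?H" unfolding H by (rule subspace_hyperplane)
  have lin: "linear (tangent_of_components A c p)"
    by (rule linear_tangent_of_components[OF assms(1) c(1,2)])
  have eq: "tangent_space A S p = tangent_of_components A c p ` ?H"
    by (rule tangent_space_slice[OF assms(1) c(1) assms(3) c(2,3)])
  show "subspace (tangent_space A S p)" unfolding eq by (rule linear_subspace_image[OF lin sub])
  have "inj (tangent_of_components A c p)"
    using components_tangent_of_components[OF assms(1) c(1,2)] by (metis injI)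
  then have "dim (tangent_space A S p) = dim ?H"
    unfolding eq by (intro dim_image_eq lin) (auto intro: inj_on_subset)
  also have "\<dots> = CARD('n) - 1"
    unfolding H by (subst dim_special_hyperplane) (auto simp: axis_in_Basis_iff)
  finally show "dim (tangent_space A S p) = CARD('n) - 1" .
qed


section \<open>Unit speed reparametrization\<close>

text \<open>\<phi> is the inverse of arc length measured from 0, so its derivative is the reciprocal
  of the speed at \<phi>. This works only near 0, since \<beta> may change its causal character
  further away.\<close>

lemma unit_speed_reparametrization:
  assumes "semi_riemannian_manifold A g \<nu>" "smooth_curve A I \<beta>" "0 \<in> I"
    "g (\<beta> 0) (velocity A \<beta> 0) (velocity A \<beta> 0) \<noteq> 0"
  obtains J \<phi> \<epsilon> r where "nonlightlike_curve A g J (\<beta> \<circ> \<phi>) \<epsilon>" "0 \<in> J" "\<phi> 0 = 0" "\<phi> ` J \<subseteq> I"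
    "r \<noteq> 0" "velocity A (\<beta> \<circ> \<phi>) 0 = r *\<^sub>R velocity A \<beta> 0"
proof -
  note at = mfd_atlas[OF assms(1)]
  define h where "h = (\<lambda>t. g (\<beta> t) (velocity A \<beta> t) (velocity A \<beta> t))"
  have oI: "open I" using assms(2) by (simp add: smooth_curve_def)
  have h: "smooth_on I h"
    unfolding h_def
    by (rule smooth_on_metric_along[OF assms(1,2)]) (rule smooth_field_along_velocity[OF at assms(2)])+
  \<comment> \<open>The sign makes \<open>\<sigma> * h\<close> positive near 0, so that its square
    root is the speed; it is also the causal character of the new curve.\<close>
  define \<sigma> where "\<sigma> = sgn (h 0)"
  have \<sigma>: "\<sigma> \<in> {-1, 1}" "\<sigma> * h 0 > 0" using assms(4) by (auto simp: \<sigma>_def h_def sgn_if)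
  have \<sigma>h: "smooth_on I (\<lambda>t. \<sigma> * h t)"
    by (rule smooth_on_bounded_linear[OF bounded_linear_mult_right oI h])
  then have "continuous_on I (\<lambda>t. \<sigma> * h t)" unfolding smooth_on_def by (metis Ck_on.simps(1))
  then have "open (I \<inter> (\<lambda>t. \<sigma> * h t) -` {0<..})"
    by (intro continuous_open_preimage oI) auto
  \<comment> \<open>The closed interval is for the antiderivative of the speed; on its interior
    \<open>K\<close> this antiderivative has a two-sided derivative.\<close>
  then obtain \<delta> where \<delta>: "\<delta> > 0" "cball 0 \<delta> \<subseteq> I \<inter> (\<lambda>t. \<sigma> * h t) -` {0<..}"
    using \<sigma> assms(3) by (metis (no_types, lifting) IntI open_contains_cball vimageI greaterThan_iff)
  have \<delta>I: "t \<in> I" "\<sigma> * h t > 0" if "t \<in> {-\<delta>..\<delta>}" for t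
    using \<delta>(2) that by (auto simp: subset_iff dist_real_def abs_le_iff)
  define K where "K = {-\<delta><..<\<delta>}"
  have K: "open K" "0 \<in> K" "K \<subseteq> I" "\<And>t. t \<in> K \<Longrightarrow> \<sigma> * h t > 0" "K \<subseteq> {-\<delta>..\<delta>}"
    using \<delta>(1) \<delta>I by (auto simp: K_def)
  have pw: "smooth_on K (\<lambda>t. (\<sigma> * h t) powr a)" for a
    by (rule smooth_on_compose[OF smooth_on_powr smooth_on_subset[OF \<sigma>h K(3)] K(1)]) (use K in auto)
  define w where "w = (\<lambda>t. (\<sigma> * h t) powr (1/2))"
  define G where "G = (\<lambda>t. (\<sigma> * h t) powr (-1/2))"
  have wG: "w t > 0" "inverse (w t) = G t" if "t \<in> K" for t
    using K(4)[OF that] by (auto simp: w_def G_def powr_minus)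
  have "continuous_on {-\<delta>..\<delta>} w"
    unfolding w_def
    by (intro continuous_on_powr' continuous_on_subset[OF \<open>continuous_on I (\<lambda>t. \<sigma> * h t)\<close>] continuous_intros)
      (use \<delta>I in force)+
  then obtain L0 where L0: "\<And>t. t \<in> {-\<delta>..\<delta>} \<Longrightarrow> (L0 has_vector_derivative w t) (at t within {-\<delta>..\<delta>})"
    using antiderivative_continuous by metis
  define L where "L = (\<lambda>t. L0 t - L0 0)"
  have L: "(L has_real_derivative w t) (at t)" if "t \<in> K" for t
  proof -
    have "(L0 has_vector_derivative w t) (at t within K)"
      using L0 K(5) that has_vector_derivative_within_subset by blast
    then have "(L0 has_real_derivative w t) (at t)"
      using at_within_open[OF that K(1)] by (simp add: has_real_derivative_iff_has_vector_derivative)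
    then show ?thesis unfolding L_def by (auto intro!: derivative_eq_intros)
  qed
  have L_less: "L x < L y" if "x \<in> K" "y \<in> K" "x < y" for x y
  proof (rule DERIV_pos_imp_increasing[OF that(3)])
    fix z assume "x \<le> z" "z \<le> y"
    then have "z \<in> K" using that by (auto simp: K_def)
    then show "\<exists>d. (L has_real_derivative d) (at z) \<and> d > 0" using L wG(1) by blast
  qed
  have L_cont: "continuous_on K L" using L DERIV_isCont continuous_at_imp_continuous_on by blast
  have L_inj: "inj_on L K" using L_less by (metis inj_onI linorder_neqE less_irrefl)
  \<comment> \<open>Invariance of domain makes the inverse continuous, as the rule for the
    derivative of an inverse requires; it also makes the new parameter domain open.\<close>
  obtain \<phi> where \<phi>: "homeomorphism K (L ` K) L \<phi>"
    using invariance_of_domain_homeomorphism[OF K(1) L_cont _ L_inj] by auto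
  define J where "J = L ` K"
  have oJ: "open J" unfolding J_def by (rule invariance_of_domain[OF L_cont K(1) L_inj])
  have L0': "L 0 = 0" by (simp add: L_def)
  then have J0: "0 \<in> J" using K(2) unfolding J_def by (metis imageI)
  have intJ: "is_interval J"
    unfolding J_def is_interval_connected_1
    by (rule connected_continuous_image[OF L_cont]) (simp add: K_def)
  have \<phi>K: "\<phi> s \<in> K" "L (\<phi> s) = s" if "s \<in> J" for s
    using \<phi> that by (auto simp: homeomorphism_def J_def)
  have \<phi>0: "\<phi> 0 = 0" using \<phi> K(2) L0' by (metis homeomorphism_apply1)
  have d\<phi>: "(\<phi> has_real_derivative G (\<phi> s)) (at s)" if s: "s \<in> J" for s
  proof -
    have "continuous (at s) \<phi>"
      using \<phi> s oJ by (metis homeomorphism_cont2 J_def continuous_on_eq_continuous_at)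
    then have "(\<phi> has_real_derivative inverse (w (\<phi> s))) (at s)"
      using wG(1)[OF \<phi>K(1)[OF s]]
      by (intro has_field_derivative_inverse_basic[where g = \<phi>, OF L[OF \<phi>K(1)[OF s]] _ _ oJ s])
        (auto simp: \<phi>K)
    then show ?thesis using wG(2)[OF \<phi>K(1)[OF s]] by simp
  qed
  have "smooth_on J \<phi>"
    by (rule smooth_on_autonomous_ode[OF oJ K(1) _ \<phi>K(1) d\<phi>]) (auto simp: G_def pw)
  moreover have \<phi>I: "\<phi> ` J \<subseteq> I" using \<phi>K K(3) by auto
  ultimately have curve: "smooth_curve A J (\<beta> \<circ> \<phi>)"
    using oJ intJ J0 by (intro smooth_curve_reparam[OF at assms(2)]) auto
  have vel: "velocity A (\<beta> \<circ> \<phi>) s = G (\<phi> s) *\<^sub>R velocity A \<beta> (\<phi> s)" if "s \<in> J" for s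
    using velocity_reparam[OF at assms(2) _ d\<phi>[OF that]] \<phi>I that by auto
  have "g ((\<beta> \<circ> \<phi>) s) (velocity A (\<beta> \<circ> \<phi>) s) (velocity A (\<beta> \<circ> \<phi>) s) = \<sigma>" if s: "s \<in> J" for s
  proof -
    have pos: "\<sigma> * h (\<phi> s) > 0" using K(4)[OF \<phi>K(1)[OF s]] .
    \<comment> \<open>Scaling the velocity by \<open>G\<close> multiplies \<open>h\<close> by the
      reciprocal of \<open>\<sigma> * h\<close>, which leaves 1/\<sigma> = \<sigma>.\<close>
    have "G (\<phi> s) * G (\<phi> s) = inverse (\<sigma> * h (\<phi> s))"
      using pos by (simp add: G_def powr_add[symmetric] powr_minus_divide field_simps)
    moreover have "inverse (\<sigma> * h (\<phi> s)) * h (\<phi> s) = \<sigma>" using pos \<sigma>(1) by auto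
    ultimately have "G (\<phi> s) * (G (\<phi> s) * h (\<phi> s)) = \<sigma>" by (metis mult.assoc)
    then show ?thesis
      by (simp add: vel[OF s] h_def linear_scale[OF metric_linear(1)[OF assms(1)]]
          linear_scale[OF metric_linear(2)[OF assms(1)]])
  qed
  moreover from this have "velocity A (\<beta> \<circ> \<phi>) s \<noteq> 0" if "s \<in> J" for s
    using that \<sigma>(1) linear_0[OF metric_linear(1)[OF assms(1)]] by fastforce
  ultimately have "nonlightlike_curve A g J (\<beta> \<circ> \<phi>) \<sigma>"
    using curve \<sigma>(1) by (simp add: nonlightlike_curve_def)
  moreover have "G (\<phi> 0) \<noteq> 0" using \<sigma>(2) \<phi>0 by (auto simp: G_def)
  ultimately show ?thesis using that J0 \<phi>0 \<phi>I vel[OF J0] by metis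
qed


section \<open>Symmetric bilinear forms\<close>

lemma scalar_if_nonnull_eigenvectors:
  fixes b :: "'v::euclidean_space \<Rightarrow> 'v \<Rightarrow> real"
  assumes b: "bilinear b" "\<And>u v. b u v = b v u" and T: "subspace T" "nondegenerate_on T b"
    and f: "linear f" "\<And>v. v \<in> T \<Longrightarrow> b v v \<noteq> 0 \<Longrightarrow> \<exists>l. f v = l *\<^sub>R v"
  shows "\<exists>l. \<forall>v\<in>T. f v = l *\<^sub>R v"
proof (cases "\<exists>w\<in>T. b w w \<noteq> 0")
  case False
  \<comment> \<open>Polarization: if all vectors of \<open>T\<close> are null, the form vanishes on
    \<open>T\<close>, and nondegeneracy leaves only the zero vector.\<close>
  have sq: "b (u + v) (u + v) = b u u + 2 * b u v + b v v" for u v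
    by (simp add: bilinear_ladd[OF b(1)] bilinear_radd[OF b(1)] b(2)[of v u])
  have "b u v = 0" if "u \<in> T" "v \<in> T" for u v
    using sq[of u v] False subspace_add[OF T(1) that] that by auto
  then have "v = 0" if "v \<in> T" for v using T(2) that by (auto simp: nondegenerate_on_def)
  then show ?thesis using linear_0[OF f(1)] by force
next
  case True
  then obtain w where w: "w \<in> T" "b w w \<noteq> 0" by blast
  then obtain l where l: "f w = l *\<^sub>R w" using f(2) by blast
  have w0: "w \<noteq> 0" using w bilinear_lzero[OF b(1)] by auto
  \<comment> \<open>The value is a polynomial in \<open>t\<close> of degree two, with leading
    coefficient \<open>b w w\<close>. It has at most two zeros, so one of 1, -1 and 2 is not a
    zero.\<close>
  have shift: "\<exists>t. t \<noteq> 0 \<and> b (v + t *\<^sub>R w) (v + t *\<^sub>R w) \<noteq> 0" for v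
  proof -
    have q: "b (v + t *\<^sub>R w) (v + t *\<^sub>R w) = b v v + 2 * t * b v w + t * t * b w w" for t
      by (simp add: bilinear_ladd[OF b(1)] bilinear_radd[OF b(1)] bilinear_lmul[OF b(1)]
          bilinear_rmul[OF b(1)] b(2)[of w v] algebra_simps)
    show ?thesis using q[of 1] q[of "-1"] q[of 2] w(2)
      by (cases "b (v + 1 *\<^sub>R w) (v + 1 *\<^sub>R w) = 0"; cases "b (v + (-1) *\<^sub>R w) (v + (-1) *\<^sub>R w) = 0")
        (force intro: exI[of _ "1::real"] exI[of _ "-1::real"] exI[of _ "2::real"])+
  qed
  have nonnull: "f v = l *\<^sub>R v" if v: "v \<in> T" "b v v \<noteq> 0" for v
  proof -
    obtain t where t: "t \<noteq> 0" "b (v + t *\<^sub>R w) (v + t *\<^sub>R w) \<noteq> 0" using shift by blast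
    obtain k where k: "f (v + t *\<^sub>R w) = k *\<^sub>R (v + t *\<^sub>R w)"
      using f(2) t(2) v(1) w(1) T(1) by (meson subspace_add subspace_scale)
    obtain j where j: "f v = j *\<^sub>R v" using f(2) v by blast
    \<comment> \<open>Comparison of the two expressions for the image of \<open>v + t w\<close>. If
      \<open>j = k\<close>, the right side vanishes, which gives \<open>k = l\<close>; otherwise
      \<open>v\<close> is a multiple of \<open>w\<close> and shares its eigenvalue.\<close>
    have e: "(j - k) *\<^sub>R v = (t * (k - l)) *\<^sub>R w"
      using k j l by (simp add: linear_add[OF f(1)] linear_scale[OF f(1)] algebra_simps)
    show ?thesis
    proof (cases "j = k")
      case True
      then show ?thesis using e t(1) w0 j by simp
    next
      case False
      then have "v = ((t * (k - l)) / (j - k)) *\<^sub>R w"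
        using arg_cong[OF e, of "\<lambda>x. (1 / (j - k)) *\<^sub>R x"] by simp
      then show ?thesis using l by (metis linear_scale[OF f(1)] scaleR_left_commute)
    qed
  qed
  have "f v = l *\<^sub>R v" if v: "v \<in> T" for v
  proof -
    obtain t where t: "t \<noteq> 0" "b (v + t *\<^sub>R w) (v + t *\<^sub>R w) \<noteq> 0" using shift by blast
    have "f (v + t *\<^sub>R w) = l *\<^sub>R (v + t *\<^sub>R w)"
      using nonnull t(2) v w(1) T(1) by (meson subspace_add subspace_scale)
    then show ?thesis using l by (simp add: linear_add[OF f(1)] linear_scale[OF f(1)] algebra_simps)
  qed
  then show ?thesis by blast
qed

text \<open>Each diagonal entry is \<open>l\<close> in whichever basis the choice in
  \<open>trace_on\<close> returns, and every basis has \<open>dim V\<close> elements.\<close>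

lemma trace_on_scalar:
  assumes "subspace V" "\<And>v. v \<in> V \<Longrightarrow> f v = l *\<^sub>R v"
  shows "trace_on V f = l * dim V"
proof -
  define B where "B = (SOME B. independent B \<and> span B = V)"
  have "\<exists>B. independent B \<and> span B = V"
    using basis_exists[of V] span_minimal[OF _ assms(1)] by (metis subset_antisym)
  from someI_ex[OF this] have B: "independent B" "span B = V" by (auto simp: B_def)
  have "representation B (f b) b = l" if "b \<in> B" for b
  proof -
    have "b \<in> span B" using that by (rule span_base)
    then show ?thesis
      using assms(2)[of b] B that by (simp add: representation_scale representation_basis)
  qed
  then have "trace_on V f = l * card B" by (simp add: trace_on_def Let_def B_def[symmetric])
  also have "card B = dim V" using dim_eq_card_independent[OF B(1)] dim_span[of B] B(2) by simp
  finally show ?thesis .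
qed

text \<open>For an indefinite form the coefficient at \<open>f i\<close> carries the sign
  \<open>e i\<close>, because pairing with \<open>f i\<close> multiplies it by \<open>e i\<close>
  and \<open>e i\<close> has square 1. The values \<open>e i\<close> being nonzero also gives
  injectivity of \<open>f\<close> and independence, and the cardinality then gives spanning.\<close>

lemma orthonormal_expansion:
  fixes b :: "'v::euclidean_space \<Rightarrow> 'v \<Rightarrow> real"
  assumes b: "bilinear b" and "finite J" "card J = DIM('v)"
    and e: "\<And>i. i \<in> J \<Longrightarrow> e i \<in> {-1, 1}"
    and orth: "\<And>i j. i \<in> J \<Longrightarrow> j \<in> J \<Longrightarrow> b (f i) (f j) = (if i = j then e i else 0)"
  shows "x = (\<Sum>i\<in>J. (e i * b x (f i)) *\<^sub>R f i)"
proof -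
  have lin: "linear (\<lambda>x. b x y)" for y using b by (simp add: bilinear_def)
  have inj: "inj_on f J" using orth e by (intro inj_onI) (metis insertE singletonD zero_neq_neg_one zero_neq_one)
  have ev: "b (\<Sum>i\<in>J. c i *\<^sub>R f i) (f j) = c j * e j" if "j \<in> J" for c j
  proof -
    have "b (\<Sum>i\<in>J. c i *\<^sub>R f i) (f j) = (\<Sum>i\<in>J. c i * b (f i) (f j))"
      by (simp add: linear_sum[OF lin] linear_scale[OF lin])
    also have "\<dots> = (\<Sum>i\<in>J. if i = j then c i * e i else 0)"
      by (rule sum.cong) (use orth that in auto)
    finally show ?thesis using that assms(2) by simp
  qed
  have span: "span (f ` J) = range (\<lambda>c. \<Sum>i\<in>J. c i *\<^sub>R f i)"
  proof -
    have 1: "(\<Sum>v\<in>f ` J. u v *\<^sub>R v) = (\<Sum>i\<in>J. (u \<circ> f) i *\<^sub>R f i)" for u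
      by (simp add: sum.reindex[OF inj])
    have 2: "(\<Sum>i\<in>J. c i *\<^sub>R f i) = (\<Sum>v\<in>f ` J. (c \<circ> the_inv_into J f) v *\<^sub>R v)" for c :: "_ \<Rightarrow> real"
      unfolding sum.reindex[OF inj] by (rule sum.cong) (auto simp: the_inv_into_f_f[OF inj])
    show ?thesis
      unfolding span_finite[OF finite_imageI[OF assms(2)]]
      by (intro equalityI image_subsetI) (subst 1 2, rule rangeI)+
  qed
  have "independent (f ` J)"
  proof (rule independent_if_scalars_zero)
    fix u v assume u: "(\<Sum>x\<in>f ` J. u x *\<^sub>R x) = 0" and "v \<in> f ` J"
    then obtain j where j: "j \<in> J" "v = f j" by auto
    have "u (f j) * e j = b 0 (f j)"
      using u ev[OF j(1), of "\<lambda>i. u (f i)"] by (simp add: sum.reindex[OF inj])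
    then show "u v = 0" using e[OF j(1)] j(2) bilinear_lzero[OF b] by auto
  qed (use assms(2) in simp)
  moreover have "dim (UNIV :: 'v set) \<le> card (f ` J)" using assms(3) card_image[OF inj] by simp
  ultimately have "x \<in> span (f ` J)" using card_ge_dim_independent[of "f ` J" UNIV] by auto
  then obtain c where c: "x = (\<Sum>i\<in>J. c i *\<^sub>R f i)" unfolding span by blast
  have "e j * b x (f j) = c j" if "j \<in> J" for j
    using ev[OF that, of c] c e[OF that] by auto
  then show ?thesis using c by simp
qed


section \<open>Totally umbilical hypersurfaces\<close>

context
  fixes A :: "('a::{t2_space,second_countable_topology}, 'n::finite) chart set"
    and g :: "'a \<Rightarrow> real ^ 'n \<Rightarrow> real ^ 'n \<Rightarrow> real"
    and \<nu> :: nat and S :: "'a set" and \<xi> :: "'a \<Rightarrow> real ^ 'n" and \<eta> :: real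
  assumes mfd: "semi_riemannian_manifold A g \<nu>"
    and hyp: "nonlightlike_hypersurface A g S"
    and normal: "unit_normal_field A g S \<xi> \<eta>"
begin

lemma normal_smooth: "smooth_field_on A S \<xi>"
  and \<eta>_cases: "\<eta> \<in> {-1, 1}"
  and normal_unit: "p \<in> S \<Longrightarrow> g p (\<xi> p) (\<xi> p) = \<eta>"
  and normal_orthogonal: "p \<in> S \<Longrightarrow> v \<in> tangent_space A S p \<Longrightarrow> g p (\<xi> p) v = 0"
  using normal by (auto simp: unit_normal_field_def)

lemma umbilical_imp_minimizes_rotation:
  assumes umb: "totally_umbilical A g S \<xi>"
    and \<alpha>: "nonlightlike_curve A g I \<alpha> \<epsilon>" "\<alpha> ` I \<subseteq> S"
  shows "minimizes_rotation A g I \<alpha> (\<xi> \<circ> \<alpha>)"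
proof -
  have curve: "smooth_curve A I \<alpha>" using \<alpha>(1) by (simp add: nonlightlike_curve_def)
  have vel: "velocity A \<alpha> s \<in> tangent_space A S (\<alpha> s)" if "s \<in> I" for s
    by (rule velocity_in_tangent_space[OF mfd_atlas[OF mfd] curve \<alpha>(2) that])
  have "\<exists>l. cov_deriv_along A g \<alpha> (\<xi> \<circ> \<alpha>) s = l *\<^sub>R velocity A \<alpha> s" if s: "s \<in> I" for s
  proof -
    have "g (\<alpha> s) (velocity A \<alpha> s) (velocity A \<alpha> s) \<noteq> 0"
      using \<alpha>(1) s by (auto simp: nonlightlike_curve_def)
    then obtain l where "shape_operator A g S \<xi> (\<alpha> s) (velocity A \<alpha> s) = l *\<^sub>R velocity A \<alpha> s"
      using umb vel[OF s] \<alpha>(2) s unfolding totally_umbilical_def by blast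
    then show ?thesis
      using cov_deriv_along_restrict[OF mfd normal_smooth curve \<alpha>(2) s]
      by (intro exI[of _ "- l"]) simp
  qed
  then have "\<exists>l. \<forall>s\<in>I. cov_deriv_along A g \<alpha> (\<xi> \<circ> \<alpha>) s = l s *\<^sub>R velocity A \<alpha> s" by metis
  moreover have "\<alpha> s \<in> S" if "s \<in> I" for s using that \<alpha>(2) by auto
  ultimately show ?thesis
    unfolding minimizes_rotation_def
    using smooth_field_on_imp_along[OF mfd_atlas[OF mfd] normal_smooth curve \<alpha>(2)]
      normal_unit normal_orthogonal \<eta>_cases vel by simp
qed

lemma minimizes_rotation_imp_umbilical:
  assumes rm: "\<And>I \<alpha> \<epsilon>. nonlightlike_curve A g I \<alpha> \<epsilon> \<Longrightarrow> \<alpha> ` I \<subseteq> S \<Longrightarrow>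
    minimizes_rotation A g I \<alpha> (\<xi> \<circ> \<alpha>)"
  shows "totally_umbilical A g S \<xi>"
  unfolding totally_umbilical_def
proof (intro ballI impI)
  fix p v assume p: "p \<in> S" and "v \<in> tangent_space A S p" and v: "g p v v \<noteq> 0"
  then obtain \<beta> I where \<beta>: "v = velocity A \<beta> 0" "smooth_curve A I \<beta>" "0 \<in> I" "\<beta> ` I \<subseteq> S" "\<beta> 0 = p"
    unfolding tangent_space_def by blast
  obtain J \<phi> \<epsilon> r where J: "nonlightlike_curve A g J (\<beta> \<circ> \<phi>) \<epsilon>" "0 \<in> J" "\<phi> 0 = 0" "\<phi> ` J \<subseteq> I"
    "r \<noteq> 0" "velocity A (\<beta> \<circ> \<phi>) 0 = r *\<^sub>R velocity A \<beta> 0"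
    by (rule unit_speed_reparametrization[OF mfd \<beta>(2,3)]) (use v \<beta> in auto)
  have sub: "(\<beta> \<circ> \<phi>) ` J \<subseteq> S" using J(4) \<beta>(4) by auto
  obtain l where l: "cov_deriv_along A g (\<beta> \<circ> \<phi>) (\<xi> \<circ> (\<beta> \<circ> \<phi>)) 0 = l *\<^sub>R (r *\<^sub>R v)"
    using rm[OF J(1) sub] J(2,6) \<beta>(1) unfolding minimizes_rotation_def by metis
  have "smooth_curve A J (\<beta> \<circ> \<phi>)" using J(1) by (simp add: nonlightlike_curve_def)
  from cov_deriv_along_restrict[OF mfd normal_smooth this sub J(2)]
  have "l *\<^sub>R (r *\<^sub>R v) = - shape_operator A g S \<xi> p (r *\<^sub>R v)"
    using l J(3,6) \<beta>(1,5) by simp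
  also have "\<dots> = r *\<^sub>R (- shape_operator A g S \<xi> p v)"
    by (simp add: linear_scale[OF linear_shape_operator[OF mfd normal_smooth p]])
  finally have "r *\<^sub>R (l *\<^sub>R v) = r *\<^sub>R (- shape_operator A g S \<xi> p v)"
    by (simp only: scaleR_left_commute)
  from scaleR_left_imp_eq[OF J(5) this] have "shape_operator A g S \<xi> p v = - l *\<^sub>R v" by simp
  then show "\<exists>l. shape_operator A g S \<xi> p v = l *\<^sub>R v" by blast
qed

text \<open>With \<open>l\<close> the common eigenvalue and m the dimension, the trace is l m, so H
  = \<eta> l, and \<eta> has square 1.\<close>

lemma umbilical_shape_operator:
  assumes "totally_umbilical A g S \<xi>" "p \<in> S" "v \<in> tangent_space A S p" "v \<noteq> 0"
  shows "shape_operator A g S \<xi> p v = (\<eta> * mean_curvature A g S \<xi> \<eta> (CARD('n) - 1) p) *\<^sub>R v"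
proof -
  let ?T = "tangent_space A S p"
  have h: "hypersurface A S" "nondegenerate_on ?T (g p)"
    using hyp assms(2) by (auto simp: nonlightlike_hypersurface_def)
  note T = tangent_space[OF mfd_atlas[OF mfd] h(1) assms(2)]
  obtain l where l: "\<And>v. v \<in> ?T \<Longrightarrow> shape_operator A g S \<xi> p v = l *\<^sub>R v"
    using scalar_if_nonnull_eigenvectors[OF metric_bilinear[OF mfd] metric_sym[OF mfd] T(1) h(2)
        linear_shape_operator[OF mfd normal_smooth assms(2)]] assms(1,2)
    unfolding totally_umbilical_def by metis
  \<comment> \<open>A nonzero tangent vector excludes dimension zero, where the division in
    \<open>mean_curvature\<close> would yield 0.\<close>
  have "CARD('n) - 1 \<noteq> 0"
    using T(2) dim_eq_0[of ?T] assms(3,4) by auto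
  moreover have "trace_on ?T (shape_operator A g S \<xi> p) = l * (CARD('n) - 1)"
    using trace_on_scalar[OF T(1) l] T(2) by simp
  ultimately have "\<eta> * mean_curvature A g S \<xi> \<eta> (CARD('n) - 1) p = \<eta> * \<eta> * l"
    by (simp add: mean_curvature_def)
  then show ?thesis using l[OF assms(3)] \<eta>_cases by auto
qed

lemma rm_frame_normal:
  assumes umb: "totally_umbilical A g S \<xi>"
    and \<alpha>: "nonlightlike_curve A g I \<alpha> \<epsilon>" "\<alpha> ` I \<subseteq> S"
    and fr: "rm_frame A g I \<alpha> \<epsilon> m n e \<kappa>" and m: "CARD('n) = m + 1"
  shows "\<exists>a. (\<forall>s\<in>I. \<xi> (\<alpha> s) = (\<Sum>i=1..m. a i *\<^sub>R n i s)) \<and>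
    (\<forall>s\<in>I. (\<Sum>i=1..m. \<epsilon> * a i * \<kappa> i s) = \<eta> * mean_curvature A g S \<xi> \<eta> m (\<alpha> s))"
proof -
  let ?V = "velocity A \<alpha>"
  have curve: "smooth_curve A I \<alpha>" and \<epsilon>: "\<epsilon> \<in> {-1, 1}"
    and V0: "\<And>s. s \<in> I \<Longrightarrow> ?V s \<noteq> 0" and VV: "\<And>s. s \<in> I \<Longrightarrow> g (\<alpha> s) (?V s) (?V s) = \<epsilon>"
    using \<alpha>(1) by (auto simp: nonlightlike_curve_def)
  have I: "open I" "convex I" "I \<noteq> {}"
    using curve by (auto simp: smooth_curve_def is_interval_convex)
  have e: "e i \<in> {-1, 1}" and n_smooth: "smooth_field_along A I \<alpha> (n i)" if "i \<in> {1..m}" for i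
    using fr that by (auto simp: rm_frame_def minimizes_rotation_def)
  have nV: "g (\<alpha> s) (n i s) (?V s) = 0"
    and nn: "j \<in> {1..m} \<Longrightarrow> g (\<alpha> s) (n i s) (n j s) = (if i = j then e i else 0)"
    and cov_n: "cov_deriv_along A g \<alpha> (n i) s = (- \<epsilon> * \<kappa> i s) *\<^sub>R ?V s"
    if "s \<in> I" "i \<in> {1..m}" for s i j
    using fr that by (auto simp: rm_frame_def minimizes_rotation_def)
  have cov_V: "cov_deriv_along A g \<alpha> ?V s = (\<Sum>i=1..m. (e i * \<kappa> i s) *\<^sub>R n i s)" if "s \<in> I" for s
    using fr that by (auto simp: rm_frame_def)
  have \<xi>_smooth: "smooth_field_along A I \<alpha> (\<xi> \<circ> \<alpha>)"
    by (rule smooth_field_on_imp_along[OF mfd_atlas[OF mfd] normal_smooth curve \<alpha>(2)])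
  have tangent: "?V s \<in> tangent_space A S (\<alpha> s)" and on_S: "\<alpha> s \<in> S" if "s \<in> I" for s
    using velocity_in_tangent_space[OF mfd_atlas[OF mfd] curve \<alpha>(2) that] that \<alpha>(2) by auto
  have \<xi>V: "g (\<alpha> s) (\<xi> (\<alpha> s)) (?V s) = 0" if "s \<in> I" for s
    using normal_orthogonal[OF on_S tangent] that by blast
  note sym = metric_sym[OF mfd] and lin = metric_linear[OF mfd]
  define l where "l s = \<eta> * mean_curvature A g S \<xi> \<eta> m (\<alpha> s)" for s
  have cov_\<xi>: "cov_deriv_along A g \<alpha> (\<xi> \<circ> \<alpha>) s = - l s *\<^sub>R ?V s" if "s \<in> I" for s
    using cov_deriv_along_restrict[OF mfd normal_smooth curve \<alpha>(2) that]
      umbilical_shape_operator[OF umb on_S tangent V0] that m by (simp add: l_def)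
  \<comment> \<open>Both covariant derivatives, of \<xi> and of \<open>n i\<close>, are multiples of
    the velocity, which is orthogonal to \<open>n i\<close> and to \<xi>. Each term of the product
    rule thus vanishes, and the interval \<open>I\<close> is convex.\<close>
  have "\<exists>c. \<forall>s\<in>I. g (\<alpha> s) (\<xi> (\<alpha> s)) (n i s) = c" if i: "i \<in> {1..m}" for i
  proof (rule has_field_derivative_zero_constant[OF I(2)])
    fix s assume s: "s \<in> I"
    have "g (\<alpha> s) (cov_deriv_along A g \<alpha> (\<xi> \<circ> \<alpha>) s) (n i s) = 0"
      using nV[OF s i] sym[of "\<alpha> s" "?V s" "n i s"]
      by (simp add: cov_\<xi>[OF s] linear_neg[OF lin(2)] linear_scale[OF lin(2)])
    moreover have "g (\<alpha> s) (\<xi> (\<alpha> s)) (cov_deriv_along A g \<alpha> (n i) s) = 0"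
      by (simp add: cov_n[OF s i] linear_neg[OF lin(1)] linear_scale[OF lin(1)] \<xi>V[OF s])
    ultimately have "((\<lambda>s. g (\<alpha> s) (\<xi> (\<alpha> s)) (n i s)) has_real_derivative 0) (at s)"
      using metric_along_has_derivative[OF mfd curve \<xi>_smooth n_smooth[OF i] s] by simp
    then show "((\<lambda>s. g (\<alpha> s) (\<xi> (\<alpha> s)) (n i s)) has_real_derivative 0) (at s within I)"
      by (rule has_field_derivative_at_within)
  qed
  then obtain c where c: "\<And>i s. i \<in> {1..m} \<Longrightarrow> s \<in> I \<Longrightarrow> g (\<alpha> s) (\<xi> (\<alpha> s)) (n i s) = c i"
    by metis
  have "\<xi> (\<alpha> s) = (\<Sum>i=1..m. (e i * c i) *\<^sub>R n i s)" if s: "s \<in> I" for s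
  proof -
    \<comment> \<open>The velocity takes the free index 0, so that \<open>{0..m}\<close> indexes a
      full orthonormal frame of m + 1 vectors; its term drops out of the expansion because \<xi> is
      normal.\<close>
    define f where "f i = (if i = 0 then ?V s else n i s)" for i
    have "\<xi> (\<alpha> s) = (\<Sum>i=0..m. ((if i = 0 then \<epsilon> else e i) * g (\<alpha> s) (\<xi> (\<alpha> s)) (f i)) *\<^sub>R f i)"
    proof (rule orthonormal_expansion[OF metric_bilinear[OF mfd]])
      show "g (\<alpha> s) (f i) (f j) = (if i = j then if i = 0 then \<epsilon> else e i else 0)"
        if "i \<in> {0..m}" "j \<in> {0..m}" for i j
        using that nV[OF s, of i] nV[OF s, of j] nn[OF s, of i j] VV[OF s]
          sym[of "\<alpha> s" "?V s" "n j s"] by (auto simp: f_def)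
    qed (use m e \<epsilon> in auto)
    also have "\<dots> = (\<Sum>i=1..m. (e i * c i) *\<^sub>R n i s)"
      using \<xi>V[OF s] c[OF _ s] by (subst sum.atLeast_Suc_atMost) (auto simp: f_def intro!: sum.cong)
    finally show ?thesis .
  qed
  moreover have "(\<Sum>i=1..m. \<epsilon> * (e i * c i) * \<kappa> i s) = l s" if s: "s \<in> I" for s
  proof -
    \<comment> \<open>The product of \<xi> with the velocity is identically zero on
      \<open>I\<close>, so this expression for its derivative must vanish; multiplying by \<epsilon>
      then isolates \<open>l s\<close>.\<close>
    have "((\<lambda>s. g (\<alpha> s) (\<xi> (\<alpha> s)) (?V s)) has_real_derivative
        - l s * \<epsilon> + (\<Sum>i=1..m. e i * \<kappa> i s * c i)) (at s)"
      using metric_along_has_derivative[OF mfd curve \<xi>_smooth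
          smooth_field_along_velocity[OF mfd_atlas[OF mfd] curve] s] c[OF _ s]
      by (simp add: cov_\<xi>[OF s] cov_V[OF s] linear_scale[OF lin(2)] linear_scale[OF lin(1)]
          linear_sum[OF lin(1)] linear_neg[OF lin(2)] VV[OF s])
    then have "((\<lambda>s. 0) has_real_derivative - l s * \<epsilon> + (\<Sum>i=1..m. e i * \<kappa> i s * c i)) (at s)"
      by (rule has_field_derivative_transform_within_open[OF _ I(1) s]) (rule \<xi>V)
    then have "(\<Sum>i=1..m. e i * \<kappa> i s * c i) = l s * \<epsilon>"
      using DERIV_unique[OF _ DERIV_const] by fastforce
    moreover have "(\<Sum>i=1..m. \<epsilon> * (e i * c i) * \<kappa> i s) = \<epsilon> * (\<Sum>i=1..m. e i * \<kappa> i s * c i)"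
      by (simp add: sum_distrib_left mult_ac)
    ultimately show ?thesis using \<epsilon> by auto
  qed
  ultimately show ?thesis unfolding l_def by (intro exI[of _ "\<lambda>i. e i * c i"]) blast
qed

end

theorem theorem7:
  fixes A :: "('a::{t2_space,second_countable_topology}, 'n::finite) chart set"
    and g :: "'a \<Rightarrow> real ^ 'n \<Rightarrow> real ^ 'n \<Rightarrow> real"
    and m \<nu> :: nat
    and S :: "'a set"
    and \<xi> :: "'a \<Rightarrow> real ^ 'n"
    and \<eta> :: real
  assumes "CARD('n) = m + 1"
    and "semi_riemannian_manifold A g \<nu>"
    and "nonlightlike_hypersurface A g S"
    and "unit_normal_field A g S \<xi> \<eta>"
  shows "(totally_umbilical A g S \<xi> \<longleftrightarrow>
           (\<forall>I \<alpha> \<epsilon>. nonlightlike_curve A g I \<alpha> \<epsilon> \<and> \<alpha> ` I \<subseteq> S \<longrightarrow>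
              minimizes_rotation A g I \<alpha> (\<xi> \<circ> \<alpha>))) \<and>
         (totally_umbilical A g S \<xi> \<longrightarrow>
           (\<forall>I \<alpha> \<epsilon> n e \<kappa>. nonlightlike_curve A g I \<alpha> \<epsilon> \<and> \<alpha> ` I \<subseteq> S \<and>
              rm_frame A g I \<alpha> \<epsilon> m n e \<kappa> \<longrightarrow>
              (\<exists>a :: nat \<Rightarrow> real.
                 (\<forall>s\<in>I. \<xi> (\<alpha> s) = (\<Sum>i=1..m. a i *\<^sub>R n i s)) \<and>
                 (\<forall>s\<in>I. (\<Sum>i=1..m. \<epsilon> * a i * \<kappa> i s) =
                   \<eta> * mean_curvature A g S \<xi> \<eta> m (\<alpha> s)))))"
proof (intro conjI iffI allI impI; (elim conjE)?)
  show "minimizes_rotation A g I \<alpha> (\<xi> \<circ> \<alpha>)"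
    if "totally_umbilical A g S \<xi>" "nonlightlike_curve A g I \<alpha> \<epsilon>" "\<alpha> ` I \<subseteq> S" for I \<alpha> \<epsilon>
    by (rule umbilical_imp_minimizes_rotation[OF assms(2-4) that])
  show "totally_umbilical A g S \<xi>"
    if "\<forall>I \<alpha> \<epsilon>. nonlightlike_curve A g I \<alpha> \<epsilon> \<and> \<alpha> ` I \<subseteq> S \<longrightarrow>
      minimizes_rotation A g I \<alpha> (\<xi> \<circ> \<alpha>)"
    using that by (intro minimizes_rotation_imp_umbilical[OF assms(2-4)]) blast
  show "\<exists>a. (\<forall>s\<in>I. \<xi> (\<alpha> s) = (\<Sum>i=1..m. a i *\<^sub>R n i s)) \<and>
      (\<forall>s\<in>I. (\<Sum>i=1..m. \<epsilon> * a i * \<kappa> i s) = \<eta> * mean_curvature A g S \<xi> \<eta> m (\<alpha> s))"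
    if "totally_umbilical A g S \<xi>" "nonlightlike_curve A g I \<alpha> \<epsilon>" "\<alpha> ` I \<subseteq> S"
      "rm_frame A g I \<alpha> \<epsilon> m n e \<kappa>" for I \<alpha> \<epsilon> n e \<kappa>
    by (rule rm_frame_normal[OF assms(2-4) that assms(1)])
qed

end
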